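(* Let $\alpha>-1$. Let $K$ be a positive integer and $\gamma_j$, $0\le j\le K$, real numbers with $\gamma_0=1$, $\gamma_K\ne0$. Set $$P(x)=\sum_{j=0}^K\gamma_jx^{K-j},\qquad q_n(x)=\sum_{j=0}^K\gamma_j\,\mathcal L^\alpha_{n-j}(x),\quad n\ge K,$$ and assume that $P(z)\neq0$ for every $z\in\mathbb C\setminus\mathbb R$ with $|z|\le1$. Denote by $N^{\mathrm{nr}}$ the number of non-real zeros of $P$ and by $N^1$ the number of real zeros of $P$ greater than $1$. If $P(1)\ne0$, then: (1) If $N^{\mathrm{nr}}=0$, then for $n\ge K$ the polynomial $q_n$ has $n$ real and simple zeros, of which $N^1$ are negative, and the zeros of $q_{n+1}$ interlace the zeros of $q_n$. (2) Otherwise, there exists $n_0$ such that for $n\ge n_0$ the polynomial $q_n$ has exactly $n-N^{\mathrm{nr}}$ real and simple zeros, of which $N^1$ are negative, and the real zeros of $q_{n+1}$ interlace the real zeros of $q_n$. If $P$ has a zero at $x=1$ of multiplicity $s$, then $q_n$ has a zero of multiplicity $s$ at $x=0$, and the zeros of $q_n/x^s$ (a polynomial of degree $n-s$) behave as follows: if $N^{\mathrm{nr}}=0$, then for $n\ge K$ the polynomial $q_n/x^s$ has $n-s$ real and simple zeros, of which $N^1$ are negative, and the zeros of $q_{n+1}/x^s$ interlace those of $q_n/x^s$; otherwise there exists $n_0$ such that for $n\ge n_0$ the polynomial $q_n/x^s$ has exactly $n-s-N^{\mathrm{nr}}$ real and simple zeros, of which $N^1$ are negative, and the real zeros of $q_{n+1}/x^s$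 interlace the real zeros of $q_n/x^s$.
   Context: $L_n^\alpha(x)=\sum_{j=0}^n\binom{n+\alpha}{n-j}\frac{(-x)^j}{j!}$ is the Laguerre polynomial, $(u)_s=u(u+1)\cdots(u+s-1)$, and $\mathcal L_n^\alpha(x)=\frac{n!}{(1+\alpha)_n}L_n^\alpha(x)$ (so that $\mathcal L_n^\alpha(0)=1$). Zeros of $P$ are counted with multiplicity. Interlacing: given two finite sets $U,V$ of real numbers ordered by size, $U$ strictly interlaces $V$ if $\min U<\min V$ and between any two consecutive elements of any of the two sets there exists one element of the other. If $U\cap V=W\ne\emptyset$, then $U$ interlaces $V$ if $U\setminus W$ strictly interlaces $V\setminus W$; if $U\cap V=\emptyset$, $U$ interlaces $V$ means that it strictly interlaces $V$. *)

theory Defs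
  imports Complex_Main "HOL-Computational_Algebra.Computational_Algebra"
begin

definition laguerre :: "real \<Rightarrow> nat \<Rightarrow> real poly" where
  "laguerre \<alpha> n =
     (\<Sum>j\<le>n. monom (((real n + \<alpha>) gchoose (n - j)) * (- 1) ^ j / fact j) j)"

text \<open>Normalised to take the value 1 at 0 (for \<open>\<alpha> > -1\<close>).\<close>

definition nlaguerre :: "real \<Rightarrow> nat \<Rightarrow> real poly" where
  "nlaguerre \<alpha> n = smult (fact n / pochhammer (1 + \<alpha>) n) (laguerre \<alpha> n)"

definition charpoly :: "nat \<Rightarrow> (nat \<Rightarrow> real) \<Rightarrow> real poly" where
  "charpoly K \<gamma> = (\<Sum>j\<le>K. monom (\<gamma> j) (K - j))"

text \<open>Only meaningful for \<open>n \<ge> K\<close>, because of the truncated subtraction \<open>n - j\<close>.\<close>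

definition lagcomb :: "real \<Rightarrow> nat \<Rightarrow> (nat \<Rightarrow> real) \<Rightarrow> nat \<Rightarrow> real poly" where
  "lagcomb \<alpha> K \<gamma> n = (\<Sum>j\<le>K. smult (\<gamma> j) (nlaguerre \<alpha> (n - j)))"

text \<open>\<open>proots\<close> is the multiset of roots, so both counts include multiplicity.\<close>

definition num_nonreal_zeros :: "real poly \<Rightarrow> nat" where
  "num_nonreal_zeros P = size {#z \<in># proots (map_poly complex_of_real P). z \<notin> \<real>#}"

definition num_zeros_gt_one :: "real poly \<Rightarrow> nat" where
  "num_zeros_gt_one P = size {#x \<in># proots P. x > 1#}"

definition real_zeros :: "real poly \<Rightarrow> real set" where
  "real_zeros p = {x. poly p x = 0}"

text \<open>Exactly \<open>m\<close> real zeros, all of them simple, exactly \<open>k\<close> of them negative.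
  The condition \<open>p \<noteq> 0\<close> ensures that the cardinalities are those of finite sets.\<close>

definition has_simple_real_zeros :: "real poly \<Rightarrow> nat \<Rightarrow> nat \<Rightarrow> bool" where
  "has_simple_real_zeros p m k \<longleftrightarrow>
     p \<noteq> 0 \<and> card (real_zeros p) = m \<and> (\<forall>x\<in>real_zeros p. order x p = 1) \<and>
     card {x \<in> real_zeros p. x < 0} = k"

definition consecutive :: "real set \<Rightarrow> real \<Rightarrow> real \<Rightarrow> bool" where
  "consecutive S a b \<longleftrightarrow> a \<in> S \<and> b \<in> S \<and> a < b \<and> S \<inter> {a<..<b} = {}"

text \<open>Empty sets can occur, for instance after common elements are removed; the minimum of
  the empty set is read as \<open>+\<infinity>\<close>, so that \<open>min U < min V\<close> forces \<open>U \<noteq> {}\<close> and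
  always holds for \<open>U \<noteq> {}\<close> and \<open>V = {}\<close>.\<close>

definition strictly_interlaces :: "real set \<Rightarrow> real set \<Rightarrow> bool" where
  "strictly_interlaces U V \<longleftrightarrow>
     finite U \<and> finite V \<and>
     U \<noteq> {} \<and> (V \<noteq> {} \<longrightarrow> Min U < Min V) \<and>
     (\<forall>a b. consecutive U a b \<longrightarrow> (\<exists>v\<in>V. a < v \<and> v < b)) \<and>
     (\<forall>a b. consecutive V a b \<longrightarrow> (\<exists>u\<in>U. a < u \<and> u < b))"

definition interlaces :: "real set \<Rightarrow> real set \<Rightarrow> bool" where
  "interlaces U V \<longleftrightarrow> (let W = U \<inter> V in strictly_interlaces (U - W) (V - W))"

end

theory Submission
  imports Defs "HOL-Complex_Analysis.Complex_Analysis" "HOL-Real_Asymp.Real_Asymp"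
begin

text \<open>
  Let \<open>T\<^sub>\<alpha>\<close> be the linear map on polynomials that sends \<open>y^j\<close> to \<open>(-x)^j / (1 + \<alpha>)\<^sub>j\<close>.
  It sends \<open>(1 + y)^n\<close> to the normalised Laguerre polynomial of degree \<open>n\<close>, hence
  \<open>(1 + y)^(n - K) P(1 + y)\<close> to \<open>q\<^sub>n\<close>.  Write \<open>f\<close> for this preimage and \<open>u = T\<^sub>\<alpha>\<^sub>+\<^sub>1 f\<close>.
  Two identities carry the whole proof:
  \<open>T\<^sub>\<alpha> f = u + x u' / (1 + \<alpha>)\<close> and \<open>T\<^sub>\<alpha> (y f) = - x u / (1 + \<alpha>)\<close>.
  A zero of \<open>P\<close> at \<open>1\<close> of multiplicity \<open>s\<close> makes \<open>f\<close> divisible by \<open>y^s\<close>, and the second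
  identity turns this into a factor \<open>x^s\<close> and the new parameter \<open>\<alpha> + s\<close>.  So it suffices to
  treat \<open>P(1) \<noteq> 0\<close>.

  Many real zeros.  The identities show that, up to a non-vanishing factor,
  \<open>T\<^sub>\<alpha> ((y - b) f)\<close> is the derivative of \<open>x^(\<alpha> + 1) e^(x / b) u\<close>.  This function vanishes at
  \<open>0\<close> and at an infinite end of the line, so by Rolle's theorem each negative zero of the preimage
  creates a positive zero of the image, and each positive zero a negative one
  (\<open>lag_transform_zeros_ge\<close>).  Since the zeros of \<open>P(1 + y)\<close> are those of \<open>P\<close> shifted by \<open>1\<close>, the polynomial
  \<open>q\<^sub>n\<close> has at least \<open>n\<close> minus the number of non-real zeros of \<open>P\<close> distinct real zeros, and at
  least \<open>N\<^sup>1\<close> of them are negative.  This holds for every \<open>n \<ge> K\<close>.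

  Not more real zeros.  If all zeros of \<open>P\<close> are real, the degree is the bound.  Otherwise the
  non-real zeros have to be found, and this is where \<open>n\<close> must be large and non-real zeros of \<open>P\<close>
  must lie outside the unit disc.  At \<open>x = m t\<close> with \<open>t\<close> non-real, the
  ratio of the Laguerre polynomials of degrees \<open>m + 1\<close> and \<open>m\<close> tends to the solution \<open>\<psi>(t)\<close> of
  \<open>\<psi> + 1 / \<psi> = 2 - t\<close> outside the unit disc: the logarithmic derivative
  \<open>g\<close> of the Laguerre polynomial satisfies \<open>t g\<^sup>2 - t g + 1 = O(1 / m)\<close> by the Laguerre
  differential equation, and the sign of its imaginary part, which comes from the
  zeros being real, selects the root.  Consequently \<open>q\<^sub>n(m t)\<close>, with \<open>m = n - K\<close>, divided by the
  Laguerre polynomial of degree \<open>m\<close> tends to \<open>P(\<psi>(t))\<close>, and by Rouche's theorem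
  every non-real zero \<open>\<zeta>\<close> of \<open>P\<close>
  attracts zeros of \<open>q\<^sub>n\<close> with the same total multiplicity near
  \<open>m (2 - \<zeta> - 1 / \<zeta>)\<close> (\<open>eventually_num_nonreal_zeros_ge\<close>).
  The two bounds together make the counts exact and the real zeros simple.

  Interlacing.  With \<open>v = x u\<close> one has \<open>q\<^sub>n\<^sub>+\<^sub>1 = q\<^sub>n - v / (1 + \<alpha>)\<close>, while \<open>q\<^sub>n\<close> has the sign of
  \<open>v'\<close> at the zeros of \<open>v\<close>.  All three polynomials have exactly the expected number of real zeros,
  so each zero of \<open>q\<^sub>n\<close> is alone in a gap between zeros of \<open>v\<close>; this fixes the signs of
  \<open>q\<^sub>n\<^sub>+\<^sub>1\<close> at the zeros of \<open>q\<^sub>n\<close>, and interlacing follows by counting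
  (\<open>interlaces_from_counts\<close>).
\<close>

section \<open>The transform behind the Laguerre combinations\<close>

text \<open>A diagonal map with multipliers \<open>(-1)^j / (1 + \<alpha>)\<^sub>j\<close>.  The multipliers for \<open>\<alpha>\<close> and \<open>\<alpha> + 1\<close>
  differ by a factor that is affine in \<open>j\<close>, which is why the parameter can be traded for a
  first-order differential operator.\<close>

definition lag_transform :: "real \<Rightarrow> real poly \<Rightarrow> real poly" where
  "lag_transform \<alpha> f =
     (\<Sum>j\<le>degree f. monom (coeff f j * (- 1) ^ j / pochhammer (1 + \<alpha>) j) j)"

lemma pochhammer_pos_shift: "\<alpha> > -1 \<Longrightarrow> pochhammer (1 + \<alpha>) j > (0::real)"
  by (rule pochhammer_pos) simp

lemma coeff_lag_transform:
  "coeff (lag_transform \<alpha> f) j = coeff f j * (- 1) ^ j / pochhammer (1 + \<alpha>) j"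
proof -
  have "coeff (lag_transform \<alpha> f) j =
      (\<Sum>i\<le>degree f. if i = j then coeff f i * (- 1) ^ i / pochhammer (1 + \<alpha>) i else 0)"
    by (simp add: lag_transform_def coeff_sum)
  also have "\<dots> = coeff f j * (- 1) ^ j / pochhammer (1 + \<alpha>) j"
    by (auto simp: coeff_eq_0)
  finally show ?thesis .
qed

lemma lag_transform_add: "lag_transform \<alpha> (f + g) = lag_transform \<alpha> f + lag_transform \<alpha> g"
  by (rule poly_eqI) (simp add: coeff_lag_transform distrib_right add_divide_distrib)

lemma lag_transform_smult: "lag_transform \<alpha> (smult c f) = smult c (lag_transform \<alpha> f)"
  by (rule poly_eqI) (simp add: coeff_lag_transform)

lemma lag_transform_0 [simp]: "lag_transform \<alpha> 0 = 0"
  by (simp add: lag_transform_def)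

lemma lag_transform_sum:
  "lag_transform \<alpha> (\<Sum>i\<in>A. f i) = (\<Sum>i\<in>A. lag_transform \<alpha> (f i))"
  by (induction A rule: infinite_finite_induct) (simp_all add: lag_transform_add)

lemma degree_lag_transform:
  assumes "\<alpha> > -1"
  shows "degree (lag_transform \<alpha> f) = degree f"
proof -
  have "coeff (lag_transform \<alpha> f) j = 0 \<longleftrightarrow> coeff f j = 0" for j
    using pochhammer_pos_shift[OF assms, of j] by (simp add: coeff_lag_transform)
  then show ?thesis
    by (simp add: degree_def)
qed

lemma lag_transform_eq_0_iff:
  assumes "\<alpha> > -1"
  shows "lag_transform \<alpha> f = 0 \<longleftrightarrow> f = 0"
proof -
  have "pochhammer (1 + \<alpha>) j \<noteq> 0" for j
    using pochhammer_pos_shift[OF assms, of j] by simp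
  then show ?thesis by (simp add: poly_eq_iff coeff_lag_transform)
qed

lemma poly_lag_transform_0: "poly (lag_transform \<alpha> f) 0 = poly f 0"
  by (simp add: poly_0_coeff_0 coeff_lag_transform)

text \<open>Multiplication by the variable shifts the index of \<open>(1 + \<alpha>)\<^sub>j\<close>, and
  \<open>(1 + \<alpha>)\<^sub>j\<^sub>+\<^sub>1 = (1 + \<alpha>) (2 + \<alpha>)\<^sub>j\<close>.\<close>

lemma lag_transform_mult_X:
  assumes "\<alpha> > -1"
  shows "lag_transform \<alpha> (pCons 0 f) = smult (- 1 / (1 + \<alpha>)) (pCons 0 (lag_transform (\<alpha> + 1) f))"
proof (rule poly_eqI)
  fix j
  show "coeff (lag_transform \<alpha> (pCons 0 f)) j =
      coeff (smult (- 1 / (1 + \<alpha>)) (pCons 0 (lag_transform (\<alpha> + 1) f))) j"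
    by (cases j) (simp_all add: coeff_lag_transform pochhammer_rec add_ac)
qed

text \<open>Here \<open>(1 + \<alpha>)\<^sub>j (1 + \<alpha> + j) = (1 + \<alpha>) (2 + \<alpha>)\<^sub>j\<close>, and the factor \<open>1 + \<alpha> + j\<close> is the action of
  \<open>1 + \<alpha> + x d/dx\<close> on \<open>x^j\<close>.\<close>

lemma lag_transform_lower:
  assumes "\<alpha> > -1"
  shows "lag_transform \<alpha> f = lag_transform (\<alpha> + 1) f +
           smult (1 / (1 + \<alpha>)) (pCons 0 (pderiv (lag_transform (\<alpha> + 1) f)))"
proof (rule poly_eqI)
  fix j
  have poch: "pochhammer (1 + \<alpha>) j > 0" "pochhammer (2 + \<alpha>) j > 0"
    using assms by (auto intro!: pochhammer_pos)
  have rel: "pochhammer (1 + \<alpha>) j * (1 + \<alpha> + real j) = (1 + \<alpha>) * pochhammer (2 + \<alpha>) j"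
    using pochhammer_rec[of "1 + \<alpha>" j] pochhammer_rec'[of "1 + \<alpha>" j] by (simp add: add_ac mult_ac)
  have "coeff f j * (- 1) ^ j / pochhammer (1 + \<alpha>) j =
        coeff f j * (- 1) ^ j * (1 + \<alpha> + real j) / ((1 + \<alpha>) * pochhammer (2 + \<alpha>) j)"
    using poch assms unfolding rel[symmetric] by simp
  also have "\<dots> = coeff f j * (- 1) ^ j / pochhammer (2 + \<alpha>) j +
       1 / (1 + \<alpha>) * (real j * (coeff f j * (- 1) ^ j / pochhammer (2 + \<alpha>) j))"
  proof -
    have "C * (A + r) / (A * p) = C / p + 1 / A * (r * (C / p))" if "A > 0" "p > 0" for A p C r :: real
      using that by (simp add: field_simps)
    from this[of "1 + \<alpha>" "pochhammer (2 + \<alpha>) j"] show ?thesis using poch assms by simp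
  qed
  finally show "coeff (lag_transform \<alpha> f) j = coeff (lag_transform (\<alpha> + 1) f +
      smult (1 / (1 + \<alpha>)) (pCons 0 (pderiv (lag_transform (\<alpha> + 1) f)))) j"
    by (cases j) (simp_all add: coeff_lag_transform coeff_pderiv add_ac)
qed

text \<open>This reduces a zero of multiplicity \<open>s\<close> of the characteristic polynomial at \<open>1\<close> to the case
  without such a zero, at the price of the larger parameter \<open>\<alpha> + s\<close>.\<close>

lemma lag_transform_monom_mult:
  assumes "\<alpha> > -1"
  obtains c where "c \<noteq> 0"
    "lag_transform \<alpha> (monom 1 s * f) = smult c (monom 1 s * lag_transform (\<alpha> + real s) f)"
proof -
  have "\<exists>c. c \<noteq> 0 \<and>
      lag_transform \<alpha> (monom 1 s * f) = smult c (monom 1 s * lag_transform (\<alpha> + real s) f)"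
    using assms
  proof (induction s arbitrary: \<alpha>)
    case 0
    then show ?case by (auto intro!: exI[of _ 1])
  next
    case (Suc s)
    obtain c where c: "c \<noteq> 0" "lag_transform (\<alpha> + 1) (monom 1 s * f) =
        smult c (monom 1 s * lag_transform (\<alpha> + 1 + real s) f)"
      using Suc.IH[of "\<alpha> + 1"] Suc.prems by auto
    have "lag_transform \<alpha> (monom 1 (Suc s) * f) = lag_transform \<alpha> (pCons 0 (monom 1 s * f))"
      by (simp add: monom_Suc)
    also have "\<dots> = smult (- 1 / (1 + \<alpha>)) (pCons 0 (smult c (monom 1 s * lag_transform (\<alpha> + 1 + real s) f)))"
      using lag_transform_mult_X[OF Suc.prems] c by simp
    also have "\<dots> = smult (- 1 / (1 + \<alpha>) * c) (monom 1 (Suc s) * lag_transform (\<alpha> + real (Suc s)) f)"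
      by (simp add: monom_Suc add_ac)
    finally show ?case
      using c Suc.prems by (intro exI[of _ "- 1 / (1 + \<alpha>) * c"]) auto
  qed
  then show ?thesis using that by blast
qed

lemma coeff_one_plus_X_power: "coeff ([:1, 1::real:] ^ n) j = real (n choose j)"
  using coeff_linear_poly_power[of j n 1 1]
  by (cases "j \<le> n") (auto simp: coeff_eq_0 degree_power_eq binomial_eq_0)

text \<open>The factor \<open>(1 + \<alpha>)\<^sub>n\<close> of the normalisation splits as
  \<open>(1 + \<alpha>)\<^sub>j (1 + \<alpha> + j)\<^sub>n\<^sub>-\<^sub>j\<close>, and its second part cancels the generalised binomial coefficient.\<close>

lemma coeff_nlaguerre_aux:
  assumes "\<alpha> > -1" "j \<le> n"
  shows "fact n / pochhammer (1 + \<alpha>) n * ((real n + \<alpha>) gchoose (n - j)) / fact j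
       = real (n choose j) / pochhammer (1 + \<alpha>) j"
proof -
  have "(real n + \<alpha>) gchoose (n - j) = pochhammer (1 + \<alpha> + real j) (n - j) / fact (n - j)"
    using assms by (simp add: gbinomial_pochhammer' of_nat_diff algebra_simps)
  moreover have "pochhammer (1 + \<alpha>) n = pochhammer (1 + \<alpha>) j * pochhammer (1 + \<alpha> + real j) (n - j)"
    using pochhammer_product[of j n "1 + \<alpha>"] assms by simp
  moreover have "pochhammer (1 + \<alpha> + real j) (n - j) > 0"
    using assms by (intro pochhammer_pos) auto
  moreover have "pochhammer (1 + \<alpha>) j > 0"
    by (rule pochhammer_pos_shift) fact
  moreover have "real (n choose j) = fact n / (fact j * fact (n - j))"
    using assms by (simp add: binomial_fact)
  ultimately show ?thesis
    by simp
qed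

lemma nlaguerre_eq_lag_transform:
  assumes "\<alpha> > -1"
  shows "nlaguerre \<alpha> n = lag_transform \<alpha> ([:1, 1:] ^ n)"
proof (rule poly_eqI)
  fix j
  have "coeff (nlaguerre \<alpha> n) j = fact n / pochhammer (1 + \<alpha>) n *
      (\<Sum>i\<le>n. if i = j then ((real n + \<alpha>) gchoose (n - i)) * (- 1) ^ i / fact i else 0)"
    by (simp add: nlaguerre_def laguerre_def coeff_sum)
  also have "\<dots> = real (n choose j) * (- 1) ^ j / pochhammer (1 + \<alpha>) j"
    using arg_cong[OF coeff_nlaguerre_aux[OF assms, of j n], of "\<lambda>x. x * (- 1) ^ j"]
    by (auto simp: binomial_eq_0 mult_ac)
  finally show "coeff (nlaguerre \<alpha> n) j = coeff (lag_transform \<alpha> ([:1, 1:] ^ n)) j"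
    by (simp add: coeff_lag_transform coeff_one_plus_X_power)
qed

lemma pcompose_as_sum: "pcompose R [:1, 1:] = (\<Sum>i\<le>degree R. smult (coeff R i) ([:1, 1::real:] ^ i))"
proof (rule poly_ext)
  fix x :: real
  have "poly (pcompose R [:1, 1:]) x = poly R (1 + x)"
    by (simp add: poly_pcompose)
  also have "\<dots> = (\<Sum>i\<le>degree R. coeff R i * (1 + x) ^ i)"
    by (rule poly_altdef)
  also have "\<dots> = poly (\<Sum>i\<le>degree R. smult (coeff R i) ([:1, 1::real:] ^ i)) x"
    by (simp add: poly_sum)
  finally show "poly (pcompose R [:1, 1:]) x =
      poly (\<Sum>i\<le>degree R. smult (coeff R i) ([:1, 1::real:] ^ i)) x" .
qed

lemma lag_transform_pcompose:
  assumes "\<alpha> > -1"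
  shows "lag_transform \<alpha> ([:1, 1:] ^ m * pcompose R [:1, 1:]) =
           (\<Sum>i\<le>degree R. smult (coeff R i) (nlaguerre \<alpha> (m + i)))"
  by (simp add: pcompose_as_sum sum_distrib_left lag_transform_sum lag_transform_smult
        nlaguerre_eq_lag_transform[OF assms] power_add)

lemma coeff_charpoly: "coeff (charpoly K \<gamma>) i = (if i \<le> K then \<gamma> (K - i) else 0)"
proof -
  have "coeff (charpoly K \<gamma>) i = (\<Sum>j\<le>K. if K - j = i then \<gamma> j else 0)"
    by (simp add: charpoly_def coeff_sum)
  also have "\<dots> = (\<Sum>j\<in>(if i \<le> K then {K - i} else {}). \<gamma> j)"
    by (intro sum.mono_neutral_cong_right) (auto split: if_splits)
  finally show ?thesis by simp
qed

lemma degree_charpoly: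
  assumes "\<gamma> 0 = 1"
  shows "degree (charpoly K \<gamma>) = K"
  using assms by (intro antisym degree_le le_degree) (auto simp: coeff_charpoly)

text \<open>With \<open>P(x) = \<Sum> \<gamma>\<^sub>j x^(K - j)\<close>, the preimage of \<open>q\<^sub>n\<close> is
  \<open>\<Sum> \<gamma>\<^sub>j (1 + y)^(n - j) = (1 + y)^(n - K) P(1 + y)\<close>.\<close>

lemma lagcomb_eq_lag_transform:
  assumes "\<alpha> > -1" "\<gamma> 0 = 1" "n \<ge> K"
  shows "lagcomb \<alpha> K \<gamma> n = lag_transform \<alpha> ([:1, 1:] ^ (n - K) * pcompose (charpoly K \<gamma>) [:1, 1:])"
proof -
  have "lagcomb \<alpha> K \<gamma> n = (\<Sum>i\<le>K. smult (\<gamma> (K - i)) (nlaguerre \<alpha> (n - K + i)))"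
    unfolding lagcomb_def using assms(3)
    by (intro sum.reindex_bij_witness[of _ "\<lambda>i. K - i" "\<lambda>i. K - i"]) auto
  also have "\<dots> = lag_transform \<alpha> ([:1, 1:] ^ (n - K) * pcompose (charpoly K \<gamma>) [:1, 1:])"
    unfolding lag_transform_pcompose[OF assms(1)] degree_charpoly[of \<gamma>, OF assms(2)]
    by (intro sum.cong) (auto simp: coeff_charpoly)
  finally show ?thesis .
qed

section \<open>Real zeros gained by Rolle's theorem\<close>

text \<open>A choice of one point of \<open>B\<close> in each gap of \<open>A\<close>, indexed by the left end point of the gap, is
  injective because gaps are disjoint.\<close>

lemma gap_selection:
  fixes A B :: "real set"
  assumes "finite A"
  assumes gaps: "\<And>a b. consecutive A a b \<Longrightarrow> \<exists>x\<in>B. a < x \<and> x < b"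
  obtains g where "inj_on g (A - {Max A})"
    "\<And>a. a \<in> A - {Max A} \<Longrightarrow> \<exists>b. consecutive A a b \<and> g a \<in> B \<and> a < g a \<and> g a < b"
proof -
  have "\<exists>x b. consecutive A a b \<and> x \<in> B \<and> a < x \<and> x < b" if "a \<in> A - {Max A}" for a
  proof -
    let ?C = "{b \<in> A. a < b}"
    have "Max A \<in> ?C"
      using that assms(1) Max_ge[of A a] by (auto intro: Max_in simp: less_le)
    then have C: "finite ?C" "?C \<noteq> {}"
      using assms(1) by auto
    have "consecutive A a (Min ?C)"
      using Min_in[OF C] Min_le[OF C(1)] that by (force simp: consecutive_def)
    with gaps show ?thesis by blast
  qed
  then obtain g where g: "\<And>a. a \<in> A - {Max A} \<Longrightarrow> \<exists>b. consecutive A a b \<and> g a \<in> B \<and> a < g a \<and> g a < b"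
    by metis
  have less: "g a < g a'" if a: "a \<in> A - {Max A}" "a' \<in> A - {Max A}" "a < a'" for a a'
  proof -
    obtain b where b: "consecutive A a b" "g a < b"
      using g[OF a(1)] by auto
    have "b \<le> a'"
      using b(1) a by (force simp: consecutive_def)
    also have "a' < g a'"
      using g[OF a(2)] by auto
    finally show ?thesis using b by simp
  qed
  have "inj_on g (A - {Max A})"
    by (rule linorder_inj_onI') (use less in \<open>fastforce simp: less_le\<close>)
  with g show ?thesis using that by blast
qed

lemma card_le_card_between:
  fixes A B :: "real set"
  assumes "finite A" "finite B"
  assumes gaps: "\<And>a b. consecutive A a b \<Longrightarrow> \<exists>x\<in>B. a < x \<and> x < b"
  shows "card (A - {Max A}) \<le> card {x \<in> B. x < Max A}"
proof -
  obtain g where g: "inj_on g (A - {Max A})"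
    "\<And>a. a \<in> A - {Max A} \<Longrightarrow> \<exists>b. consecutive A a b \<and> g a \<in> B \<and> a < g a \<and> g a < b"
    using gap_selection[OF assms(1) gaps] by blast
  have "g a \<in> {x \<in> B. x < Max A}" if a: "a \<in> A - {Max A}" for a
  proof -
    obtain b where "consecutive A a b" "g a \<in> B" "g a < b"
      using g(2)[OF a] by auto
    moreover from this have "b \<le> Max A"
      using assms(1) by (intro Max_ge) (auto simp: consecutive_def)
    ultimately show ?thesis by auto
  qed
  then have "g ` (A - {Max A}) \<subseteq> {x \<in> B. x < Max A}" by blast
  then show ?thesis
    using g(1) assms(2) by (intro card_inj_on_le) auto
qed

lemma sgn_poly_at_top:
  fixes p :: "real poly"
  assumes "p \<noteq> 0"
  shows "\<exists>N. \<forall>x\<ge>N. sgn (poly p x) = sgn (lead_coeff p)"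
proof -
  have "lead_coeff (smult (lead_coeff p) p) > 0"
    using assms by (simp add: zero_less_mult_iff not_less order_class.le_less) (metis leading_coeff_0_iff linorder_neqE)
  then obtain N where N: "\<And>x. x \<ge> N \<Longrightarrow> poly (smult (lead_coeff p) p) x > 0"
    using poly_pinfty_gt_lc[of "smult (lead_coeff p) p"] by (meson less_le_trans)
  have "sgn (poly p x) = sgn (lead_coeff p)" if "x \<ge> N" for x
    using N[OF that] by (auto simp: zero_less_mult_iff)
  then show ?thesis by blast
qed

lemma poly_same_sgn:
  fixes p :: "real poly"
  assumes "x \<le> y" "\<And>z. x \<le> z \<Longrightarrow> z \<le> y \<Longrightarrow> poly p z \<noteq> 0"
  shows "sgn (poly p x) = sgn (poly p y)"
proof (rule ccontr)
  assume neq: "sgn (poly p x) \<noteq> sgn (poly p y)"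
  with assms(1) have "x < y" by (cases "x = y") auto
  moreover have "poly p x * poly p y < 0"
    using neq assms(2)[of x] assms(2)[of y] assms(1)
    by (auto simp: sgn_if mult_less_0_iff split: if_splits)
  ultimately obtain z where "x < z" "z < y" "poly p z = 0"
    using poly_IVT by blast
  then show False using assms(2)[of z] by auto
qed

lemma sgn_poly_beyond:
  fixes p :: "real poly"
  assumes "\<And>x. x > M \<Longrightarrow> poly p x \<noteq> 0" "x > M"
  shows "sgn (poly p x) = sgn (lead_coeff p)"
proof -
  have "p \<noteq> 0" using assms by force
  then obtain N where N: "\<And>x. x \<ge> N \<Longrightarrow> sgn (poly p x) = sgn (lead_coeff p)"
    using sgn_poly_at_top by blast
  have "sgn (poly p x) = sgn (poly p (max x N))"
    by (rule poly_same_sgn) (use assms in auto)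
  with N[of "max x N"] show ?thesis by simp
qed

lemma sgn_poly_before:
  fixes p :: "real poly"
  assumes "\<And>x. x < M \<Longrightarrow> poly p x \<noteq> 0" "x < M"
  shows "sgn (poly p x) = (- 1) ^ degree p * sgn (lead_coeff p)"
proof -
  let ?p = "pcompose p [:0, -1:]"
  have "sgn (poly ?p (- x)) = sgn (lead_coeff ?p)"
    by (rule sgn_poly_beyond[of "- M"]) (use assms in \<open>auto simp: poly_pcompose\<close>)
  moreover have "lead_coeff ?p = lead_coeff p * (- 1) ^ degree p"
    by (subst lead_coeff_comp) auto
  ultimately show ?thesis
    by (simp add: poly_pcompose sgn_mult mult_ac power_0_Suc)
qed

text \<open>The polynomial factor in the derivative of \<open>x^(\<alpha> + 1) e^(x / b) u(x)\<close>, up to the constant \<open>b\<close>.\<close>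

definition rolle_step :: "real \<Rightarrow> real \<Rightarrow> real poly \<Rightarrow> real poly" where
  "rolle_step \<alpha> b u = pCons 0 u + smult (b * (1 + \<alpha>)) u + smult b (pCons 0 (pderiv u))"

lemma poly_rolle_step:
  "poly (rolle_step \<alpha> b u) x = (x + b * (1 + \<alpha>)) * poly u x + b * x * poly (pderiv u) x"
  by (simp add: rolle_step_def algebra_simps)

lemma rolle_step_lead:
  assumes "u \<noteq> 0"
  shows "lead_coeff (rolle_step \<alpha> b u) = lead_coeff u" "rolle_step \<alpha> b u \<noteq> 0"
proof -
  have top: "coeff (rolle_step \<alpha> b u) (Suc (degree u)) = lead_coeff u"
    by (simp add: rolle_step_def coeff_pderiv coeff_eq_0)
  moreover have "degree (rolle_step \<alpha> b u) \<le> Suc (degree u)"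
    using degree_pderiv[of u] by (auto simp: rolle_step_def coeff_pderiv coeff_pCons coeff_eq_0 intro!: degree_le split: nat.splits)
  ultimately have "degree (rolle_step \<alpha> b u) = Suc (degree u)"
    using assms le_degree[of "rolle_step \<alpha> b u" "Suc (degree u)"] by auto
  with top show "lead_coeff (rolle_step \<alpha> b u) = lead_coeff u" by simp
  with assms show "rolle_step \<alpha> b u \<noteq> 0" by auto
qed

text \<open>The function \<open>F = x^(\<alpha> + 1) e^(x / b) u\<close> vanishes at \<open>0\<close> because \<open>\<alpha> + 1 > 0\<close>, so Rolle's theorem
  gives as many positive zeros of \<open>F'\<close> as \<open>u\<close> has.  For \<open>b < 0\<close> it also decays at infinity, which
  gives one more, beyond the last zero of \<open>u\<close>.\<close>

lemma rolle_positive_zeros: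
  fixes u :: "real poly"
  assumes "\<alpha> > -1" "b \<noteq> 0" "u \<noteq> 0"
  defines "Q \<equiv> rolle_step \<alpha> b u"
  shows "card {x. x > 0 \<and> poly u x = 0} + (if b < 0 then 1 else 0) \<le> card {x. x > 0 \<and> poly Q x = 0}"
proof -
  define F where "F = (\<lambda>x. x powr (\<alpha> + 1) * exp (x / b) * poly u x)"
  define A where "A = insert 0 {x. x > 0 \<and> poly u x = 0}"
  define B where "B = {x. x > 0 \<and> poly Q x = 0}"
  have "Q \<noteq> 0" using rolle_step_lead(2)[OF assms(3)] by (simp add: Q_def)
  then have finB: "finite B"
    using poly_roots_finite[of Q] by (auto simp: B_def intro: finite_subset[rotated])
  have finA: "finite A"
    using poly_roots_finite[OF assms(3)] by (auto simp: A_def intro: finite_subset[rotated])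
  have deriv: "(F has_real_derivative x powr \<alpha> * exp (x / b) * poly Q x / b) (at x)" if "x > 0" for x
  proof -
    have "((\<lambda>x. x powr (\<alpha> + 1)) has_real_derivative (\<alpha> + 1) * x powr \<alpha>) (at x)"
      using has_real_derivative_powr[OF that, of "\<alpha> + 1"] by simp
    then have "(F has_real_derivative ((\<alpha> + 1) * x powr \<alpha> * exp (x / b) * poly u x
        + x powr (\<alpha> + 1) * (exp (x / b) / b) * poly u x
        + x powr (\<alpha> + 1) * exp (x / b) * poly (pderiv u) x)) (at x)"
      unfolding F_def using that assms(2)
      by (auto intro!: derivative_eq_intros simp: field_simps)
    moreover have "(\<alpha> + 1) * x powr \<alpha> * exp (x / b) * poly u x
        + x powr (\<alpha> + 1) * (exp (x / b) / b) * poly u x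
        + x powr (\<alpha> + 1) * exp (x / b) * poly (pderiv u) x
        = x powr \<alpha> * exp (x / b) * poly Q x / b"
      using that assms(2) by (simp add: Q_def poly_rolle_step powr_add field_simps)
    ultimately show ?thesis by simp
  qed
  then have diff: "F differentiable (at x)" if "x > 0" for x
    using that real_differentiable_def by blast
  have cont: "continuous_on {a..c} F" if "a \<ge> 0" for a c
    unfolding F_def using that assms(1,2)
    by (intro continuous_intros continuous_on_powr') auto
  have FA: "F a = 0" if "a \<in> A" for a
    using that by (auto simp: A_def F_def)
  have gaps: "\<exists>x\<in>B. a < x \<and> x < c" if "consecutive A a c" for a c
  proof -
    have ac: "a \<in> A" "c \<in> A" "a < c" "a \<ge> 0"
      using that by (auto simp: consecutive_def A_def)
    have "\<exists>z. a < z \<and> z < c \<and> (F has_real_derivative 0) (at z)"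
      by (rule Rolle) (use ac FA cont in \<open>auto intro!: diff\<close>)
    then obtain z where z: "a < z" "z < c" "(F has_real_derivative 0) (at z)" by blast
    have "z powr \<alpha> * exp (z / b) * poly Q z / b = 0"
      using DERIV_unique[OF deriv[of z] z(3)] ac z by simp
    then have "poly Q z = 0" using z ac assms(2) by auto
    then show ?thesis using z ac by (intro bexI[of _ z]) (auto simp: B_def)
  qed
  have A_eq: "card (A - {Max A}) = card {x. x > 0 \<and> poly u x = 0}"
  proof -
    have "Max A \<in> A" using finA by (intro Max_in) (auto simp: A_def)
    then have "card (A - {Max A}) = card A - 1" by simp
    also have "card A = Suc (card {x. x > 0 \<and> poly u x = 0})"
      using finA unfolding A_def by (subst card_insert_disjoint) auto
    finally show ?thesis by simp
  qed
  have le: "card {x. x > 0 \<and> poly u x = 0} \<le> card {x \<in> B. x < Max A}"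
    using card_le_card_between[OF finA finB gaps] A_eq by simp
  show ?thesis
  proof (cases "b < 0")
    case False
    have "card {x \<in> B. x < Max A} \<le> card B"
      by (rule card_mono) (use finB in auto)
    with le False show ?thesis by (simp add: B_def)
  next
    case True
    define M where "M = Max A"
    have "M \<in> A" using finA unfolding M_def by (intro Max_in) (auto simp: A_def)
    then have M: "M \<in> A" "M \<ge> 0" by (auto simp: A_def)
    have no_zero: "poly u x \<noteq> 0" if "x > M" for x
      using that M Max_ge[OF finA, of x] by (auto simp: A_def M_def)
    \<comment> \<open>Instead of a limit at infinity, compare signs: F moves away from 0 somewhere right after M,
      where Q has the sign opposite to u since b < 0, whereas Q and u share their leading coefficient.\<close>
    have "\<exists>z>M. poly Q z = 0"
    proof (rule ccontr)
      assume "\<not> (\<exists>z>M. poly Q z = 0)"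
      then have Q: "sgn (poly Q x) = sgn (lead_coeff u)" if "x > M" for x
        using sgn_poly_beyond[of M Q x] that rolle_step_lead(1)[OF assms(3), of \<alpha> b]
        by (auto simp: Q_def)
      have u: "sgn (poly u (M + 1)) = sgn (lead_coeff u)"
        by (rule sgn_poly_beyond[of M]) (use no_zero in auto)
      have "\<exists>l z. M < z \<and> z < M + 1 \<and> (F has_real_derivative l) (at z) \<and>
              F (M + 1) - F M = (M + 1 - M) * l"
        by (rule MVT) (use M cont in \<open>auto intro!: diff\<close>)
      then obtain z where z: "M < z" "(F has_real_derivative F (M + 1)) (at z)"
        using FA[OF M(1)] by auto
      then have "F (M + 1) = z powr \<alpha> * exp (z / b) * poly Q z / b"
        using deriv[of z] M by (auto intro: DERIV_unique)
      then have "sgn (F (M + 1)) = - sgn (poly Q z)"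
        using True z M by (simp add: sgn_mult sgn_divide)
      moreover have "sgn (F (M + 1)) = sgn (poly u (M + 1))"
        using M by (simp add: F_def sgn_mult)
      ultimately have "sgn (lead_coeff u) = 0"
        using Q[OF z(1)] u by simp
      then show False using assms(3) by (simp add: sgn_eq_0_iff)
    qed
    then obtain z where z: "z > M" "poly Q z = 0" by blast
    have "Suc (card {x \<in> B. x < Max A}) = card (insert z {x \<in> B. x < Max A})"
      using finB z by (subst card_insert_disjoint) (auto simp: M_def)
    also have "\<dots> \<le> card B"
      by (rule card_mono) (use finB z M in \<open>auto simp: B_def\<close>)
    finally show ?thesis using le True by (simp add: B_def)
  qed
qed

lemma card_negative_zeros_reflect:
  "card {x::real. x < 0 \<and> poly p x = 0} = card {x. x > 0 \<and> poly (pcompose p [:0, -1:]) x = 0}"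
  by (rule bij_betw_same_card[of uminus])
     (auto simp: bij_betw_def poly_pcompose inj_on_def image_iff intro!: exI[of _ "- _"])

lemma rolle_step_reflect:
  "pcompose (rolle_step \<alpha> b u) [:0, -1:] = - rolle_step \<alpha> (- b) (pcompose u [:0, -1:])"
  by (rule poly_ext) (simp add: poly_pcompose poly_rolle_step pderiv_pcompose pderiv_pCons algebra_simps)

lemma rolle_negative_zeros:
  fixes u :: "real poly"
  assumes "\<alpha> > -1" "b \<noteq> 0" "u \<noteq> 0"
  shows "card {x. x < 0 \<and> poly u x = 0} + (if b > 0 then 1 else 0) \<le>
         card {x. x < 0 \<and> poly (rolle_step \<alpha> b u) x = 0}"
proof -
  have "pcompose u [:0, -1:] \<noteq> 0"
    using assms(3) by (simp add: pcompose_eq_0_iff)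
  from rolle_positive_zeros[OF assms(1) _ this, of "- b"] assms(2) show ?thesis
    by (simp add: card_negative_zeros_reflect rolle_step_reflect)
qed

lemma lag_transform_linear_factor:
  assumes "\<alpha> > -1"
  shows "lag_transform \<alpha> ([:- b, 1:] * f) =
           smult (- 1 / (1 + \<alpha>)) (rolle_step \<alpha> b (lag_transform (\<alpha> + 1) f))"
proof -
  have "[:- b, 1:] * f = pCons 0 f + smult (- b) f"
    by (simp add: mult_pCons_left)
  then have "lag_transform \<alpha> ([:- b, 1:] * f) =
      lag_transform \<alpha> (pCons 0 f) + smult (- b) (lag_transform \<alpha> f)"
    by (simp only: lag_transform_add lag_transform_smult)
  also have "\<dots> = smult (- 1 / (1 + \<alpha>)) (rolle_step \<alpha> b (lag_transform (\<alpha> + 1) f))"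
    unfolding lag_transform_mult_X[OF assms] lag_transform_lower[OF assms, of f]
  proof (rule poly_ext)
    fix x
    have "- 1 / A * (x * v) + - b * (v + 1 / A * (x * w)) = - 1 / A * ((x + b * A) * v + b * x * w)"
      if "A > 0" for A v w :: real
      using that by (simp add: field_simps)
    from this[of "1 + \<alpha>"] show "poly (smult (- 1 / (1 + \<alpha>)) (pCons 0 (lag_transform (\<alpha> + 1) f)) +
        smult (- b) (lag_transform (\<alpha> + 1) f +
          smult (1 / (1 + \<alpha>)) (pCons 0 (pderiv (lag_transform (\<alpha> + 1) f))))) x =
      poly (smult (- 1 / (1 + \<alpha>)) (rolle_step \<alpha> b (lag_transform (\<alpha> + 1) f))) x"
      using assms by (simp add: poly_rolle_step)
  qed
  finally show ?thesis .
qed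

text \<open>Split off the real zeros \<open>b\<close> of \<open>f\<close> one at a time, moving to the parameter \<open>\<alpha> + 1\<close>; each
  contributes one zero of the opposite sign.  The induction ends at a polynomial without real
  zeros, for which the bound is trivial, so non-real zeros of \<open>f\<close> do no harm.\<close>

lemma lag_transform_zeros_ge:
  assumes "\<alpha> > -1" "poly f 0 \<noteq> 0"
  shows "size {#x \<in># proots f. x < 0#} \<le> card {x. x > 0 \<and> poly (lag_transform \<alpha> f) x = 0} \<and>
         size {#x \<in># proots f. x > 0#} \<le> card {x. x < 0 \<and> poly (lag_transform \<alpha> f) x = 0}"
  using assms
proof (induction "size (proots f)" arbitrary: f \<alpha>)
  case 0
  then show ?case by simp
next
  case (Suc k)
  have "f \<noteq> 0" using Suc.prems by auto
  obtain b where "b \<in># proots f" using Suc.hyps(2) by (metis Zero_not_Suc multiset_nonemptyE size_empty)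
  then have "poly f b = 0" using \<open>f \<noteq> 0\<close> by simp
  then obtain g where g: "f = [:- b, 1:] * g" by (metis dvdE poly_eq_0_iff_dvd)
  have "b \<noteq> 0" "poly g 0 \<noteq> 0" "g \<noteq> 0" using Suc.prems(2) unfolding g by auto
  have pr: "proots f = add_mset b (proots g)"
    unfolding g using \<open>g \<noteq> 0\<close> by (subst proots_mult) auto
  let ?u = "lag_transform (\<alpha> + 1) g"
  have "?u \<noteq> 0" using \<open>g \<noteq> 0\<close> Suc.prems(1) by (simp add: lag_transform_eq_0_iff)
  have IH: "size {#x \<in># proots g. x < 0#} \<le> card {x. x > 0 \<and> poly ?u x = 0}"
           "size {#x \<in># proots g. x > 0#} \<le> card {x. x < 0 \<and> poly ?u x = 0}"
    using Suc.hyps(1)[of g "\<alpha> + 1"] Suc.hyps(2) Suc.prems(1) \<open>poly g 0 \<noteq> 0\<close> pr by auto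
  have z: "poly (lag_transform \<alpha> f) x = 0 \<longleftrightarrow> poly (rolle_step \<alpha> b ?u) x = 0" for x
    using Suc.prems(1) unfolding g lag_transform_linear_factor[OF Suc.prems(1)] by simp
  show ?case
    unfolding z pr
    using IH rolle_positive_zeros[OF Suc.prems(1) \<open>b \<noteq> 0\<close> \<open>?u \<noteq> 0\<close>]
      rolle_negative_zeros[OF Suc.prems(1) \<open>b \<noteq> 0\<close> \<open>?u \<noteq> 0\<close>] \<open>b \<noteq> 0\<close>
    by (auto split: if_splits)
qed

section \<open>Interlacing from exact counts\<close>

text \<open>There are as many gaps of \<open>A\<close> as points of \<open>B\<close>, so the injective choice of a point in each gap is
  onto and no gap can hold two points.\<close>

lemma gap_unique:
  fixes A B :: "real set"
  assumes "finite A" "finite B" "card A = Suc (card B)"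
  assumes gaps: "\<And>a b. consecutive A a b \<Longrightarrow> \<exists>x\<in>B. a < x \<and> x < b"
  assumes "x \<in> B"
  shows "\<exists>a b. consecutive A a b \<and> B \<inter> {a<..<b} = {x}"
proof -
  obtain g where g: "inj_on g (A - {Max A})"
    "\<And>a. a \<in> A - {Max A} \<Longrightarrow> \<exists>b. consecutive A a b \<and> g a \<in> B \<and> a < g a \<and> g a < b"
    using gap_selection[OF assms(1) gaps] by blast
  have "A \<noteq> {}" using assms(3) by auto
  then have "card (A - {Max A}) = card B"
    using assms(1,3) Max_in[of A] by simp
  then have img: "g ` (A - {Max A}) = B"
    using g assms(1,2) by (intro card_subset_eq) (auto simp: card_image)
  then obtain a where a: "a \<in> A - {Max A}" "x = g a" using assms(5) by blast
  obtain b where b: "consecutive A a b" "a < x" "x < b" using g(2)[OF a(1)] a(2) by auto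
  have only: "y = x" if y: "y \<in> B" "a < y" "y < b" for y
  proof -
    obtain a' where a': "a' \<in> A - {Max A}" "y = g a'" using img y by blast
    obtain b' where b': "consecutive A a' b'" "a' < y" "y < b'" using g(2)[OF a'(1)] a'(2) by auto
    have "a \<in> A" "a' \<in> A" using a(1) a'(1) by auto
    then have "\<not> a < a'" "\<not> a' < a"
      using b b' y unfolding consecutive_def disjoint_iff greaterThanLessThan_iff
      by (meson less_trans)+
    then have "a' = a" by simp
    then show ?thesis using a(2) a'(2) by simp
  qed
  have "B \<inter> {a<..<b} = {x}"
  proof
    show "B \<inter> {a<..<b} \<subseteq> {x}"
      using only unfolding subset_iff Int_iff greaterThanLessThan_iff singleton_iff by blast
  qed (use b assms(5) in auto)
  then show ?thesis using b(1) by blast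
qed

lemma sgn_right_of_zero:
  fixes p :: "real poly"
  assumes "poly p a = 0" "poly (pderiv p) a \<noteq> 0"
    and nz: "\<And>x. a < x \<Longrightarrow> x < b \<Longrightarrow> poly p x \<noteq> 0"
    and "a < x" "x < b"
  shows "sgn (poly p x) = sgn (poly (pderiv p) a)"
proof -
  have main: "poly p x > 0" if p: "poly p a = 0" "poly (pderiv p) a > 0"
      "\<And>x. a < x \<Longrightarrow> x < b \<Longrightarrow> poly p x \<noteq> 0" for p :: "real poly"
  proof -
    obtain d where d: "d > 0" "\<And>h. 0 < h \<Longrightarrow> h < d \<Longrightarrow> poly p a < poly p (a + h)"
      using DERIV_pos_inc_right[OF poly_DERIV p(2)] by blast
    define h where "h = min (d / 2) (x - a)"
    have h: "0 < h" "h < d" "a + h \<le> x" using d assms(4) by (auto simp: h_def)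
    have "sgn (poly p (a + h)) = sgn (poly p x)"
      by (rule poly_same_sgn) (use h assms(5) p(3) in auto)
    moreover have "poly p (a + h) > 0" using d(2)[of h] h p(1) by simp
    ultimately show ?thesis by (metis sgn_1_pos)
  qed
  show ?thesis
  proof (cases "poly (pderiv p) a > 0")
    case True
    then show ?thesis using main[of p] assms by simp
  next
    case False
    then show ?thesis using main[of "- p"] assms by (simp add: pderiv_minus)
  qed
qed

lemma sgn_left_of_zero:
  fixes p :: "real poly"
  assumes "poly p b = 0" "poly (pderiv p) b \<noteq> 0"
    and nz: "\<And>x. a < x \<Longrightarrow> x < b \<Longrightarrow> poly p x \<noteq> 0"
    and "a < x" "x < b"
  shows "sgn (poly p x) = - sgn (poly (pderiv p) b)"
  using sgn_right_of_zero[of "pcompose p [:0, -1:]" "- b" "- a" "- x"] assms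
  by (simp add: poly_pcompose pderiv_pcompose pderiv_pCons sgn_minus)

text \<open>Between two consecutive zeros of \<open>v\<close> the derivative of \<open>v\<close>, hence \<open>q\<close>, changes sign.  The count
  leaves room for exactly one zero \<open>x\<close> of \<open>q\<close> in each gap, and there \<open>r(x) = - c v(x)\<close>.  So \<open>q\<close> has
  the sign of \<open>- r(x)\<close> just before \<open>x\<close> and that of \<open>r(x)\<close> just after.  It follows that \<open>r\<close> has a zero
  between consecutive zeros of \<open>q\<close>, and, by the degrees and leading coefficients, one on either
  side of all of them.  Since \<open>r\<close> has just one zero more than \<open>q\<close>, these are all.  Non-real zeros of
  \<open>v\<close>, \<open>q\<close> and \<open>r\<close> are allowed, which is why signs are used and not the monotonicity of \<open>q / v\<close>.\<close>

lemma interlaces_from_counts: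
  fixes v q r :: "real poly"
  defines "Z \<equiv> real_zeros v" and "X \<equiv> real_zeros q" and "Y \<equiv> real_zeros r"
  assumes nz: "v \<noteq> 0" "q \<noteq> 0" "r \<noteq> 0"
    and simple: "\<And>z. poly v z = 0 \<Longrightarrow> poly (pderiv v) z \<noteq> 0"
    and q_at_Z: "\<And>z. poly v z = 0 \<Longrightarrow> sgn (poly q z) = sgn (poly (pderiv v) z)"
    and r_eq: "\<And>x. poly r x = poly q x - c * poly v x" and "c > 0"
    and cards: "card Z = Suc (card X)" "card Y = Suc (card X)"
    and deg: "degree r = Suc (degree q)"
    and lead: "sgn (lead_coeff r) = - sgn (lead_coeff q)"
  shows "interlaces Y X"
proof -
  have fin: "finite Z" "finite X" "finite Y"
    unfolding Z_def X_def Y_def real_zeros_def using nz by (auto intro: poly_roots_finite)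
  have sgn_v_gap: "sgn (poly v x) = sgn (poly (pderiv v) a)" "sgn (poly v x) = - sgn (poly (pderiv v) b)"
    if gap: "consecutive Z a b" "a < x" "x < b" for a b x
  proof -
    have "poly v y \<noteq> 0" if "a < y" "y < b" for y
      using gap(1) that by (auto simp: consecutive_def Z_def real_zeros_def)
    moreover have "poly v a = 0" "poly v b = 0"
      using gap(1) by (auto simp: consecutive_def Z_def real_zeros_def)
    ultimately show "sgn (poly v x) = sgn (poly (pderiv v) a)" "sgn (poly v x) = - sgn (poly (pderiv v) b)"
      using gap(2,3) simple by (blast intro: sgn_right_of_zero sgn_left_of_zero)+
  qed
  have gapsZ: "\<exists>x\<in>X. a < x \<and> x < b" if ab: "consecutive Z a b" for a b
  proof -
    have *: "a < b" "poly v a = 0" "poly v b = 0" using ab by (auto simp: consecutive_def Z_def real_zeros_def)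
    have "sgn (poly q a) = - sgn (poly q b)"
      using sgn_v_gap[OF ab, of "(a + b) / 2"] * q_at_Z by auto
    moreover have "poly q a \<noteq> 0" using q_at_Z[of a] simple[of a] * by (metis sgn_eq_0_iff)
    ultimately have "poly q a * poly q b < 0"
      by (auto simp: sgn_if mult_less_0_iff split: if_splits)
    then show ?thesis using poly_IVT[OF *(1)] by (auto simp: X_def real_zeros_def)
  qed
  have sides: "poly r x \<noteq> 0 \<and> (\<exists>a<x. \<forall>y. a < y \<and> y < x \<longrightarrow> sgn (poly q y) = - sgn (poly r x)) \<and>
      (\<exists>b>x. \<forall>y. x < y \<and> y < b \<longrightarrow> sgn (poly q y) = sgn (poly r x))" if x: "x \<in> X" for x
  proof -
    obtain a b where ab: "consecutive Z a b" "X \<inter> {a<..<b} = {x}"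
      using gap_unique[OF fin(1,2) cards(1) gapsZ x] by blast
    have "x \<in> {a<..<b}" using ab(2) by blast
    then have axb: "a < x" "x < b" "poly v a = 0" "poly v b = 0"
      using ab by (auto simp: consecutive_def Z_def real_zeros_def)
    have q_nz: "poly q y \<noteq> 0" if "a \<le> y" "y \<le> b" "y \<noteq> x" for y
    proof (cases "y = a \<or> y = b")
      case True
      then show ?thesis using q_at_Z[of y] simple[of y] axb by (metis sgn_eq_0_iff)
    next
      case False
      then have "y \<in> {a<..<b}" using that by auto
      then have "y \<notin> X" using ab(2) that(3) by blast
      then show ?thesis by (simp add: X_def real_zeros_def)
    qed
    have "poly r x = - c * poly v x" using x r_eq[of x] by (simp add: X_def real_zeros_def)
    then have sr: "sgn (poly r x) = - sgn (poly v x)" using \<open>c > 0\<close> by (simp add: sgn_mult sgn_minus)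
    have "sgn (poly q y) = - sgn (poly r x)" if "a < y" "y < x" for y
      using poly_same_sgn[of a y q] q_nz that axb q_at_Z[of a] sgn_v_gap(1)[OF ab(1) axb(1,2)] sr by force
    moreover have "sgn (poly q y) = sgn (poly r x)" if "x < y" "y < b" for y
      using poly_same_sgn[of y b q] q_nz that axb q_at_Z[of b] sgn_v_gap(2)[OF ab(1) axb(1,2)] sr by force
    moreover have "sgn (poly r x) \<noteq> 0"
      using sgn_v_gap(1)[OF ab(1) axb(1,2)] simple[OF axb(3)] sr by (simp add: sgn_eq_0_iff)
    ultimately show ?thesis using axb by (auto simp: sgn_eq_0_iff)
  qed
  have disj: "x \<notin> Y" if "x \<in> X" for x
    using sides[OF that] by (simp add: Y_def real_zeros_def)
  have betweenX: "\<exists>y\<in>Y. a < y \<and> y < b" if ab: "consecutive X a b" for a b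
  proof -
    have ab': "a \<in> X" "b \<in> X" "a < b" using ab by (auto simp: consecutive_def)
    obtain b0 where b0: "b0 > a" "\<And>y. a < y \<Longrightarrow> y < b0 \<Longrightarrow> sgn (poly q y) = sgn (poly r a)"
      using sides[OF ab'(1)] by blast
    obtain a0 where a0: "a0 < b" "\<And>y. a0 < y \<Longrightarrow> y < b \<Longrightarrow> sgn (poly q y) = - sgn (poly r b)"
      using sides[OF ab'(2)] by blast
    obtain y1 where y1: "a < y1" "y1 < min b0 b" using dense[of a "min b0 b"] b0 ab' by auto
    obtain y2 where y2: "max a0 y1 < y2" "y2 < b" using dense[of "max a0 y1" b] a0 y1 by auto
    have "sgn (poly q y1) = sgn (poly q y2)"
      by (rule poly_same_sgn) (use y1 y2 ab in \<open>auto simp: consecutive_def X_def real_zeros_def\<close>)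
    then have "sgn (poly r a) = - sgn (poly r b)" using b0(2)[of y1] a0(2)[of y2] y1 y2 by auto
    moreover have "poly r a \<noteq> 0" using sides[OF ab'(1)] by blast
    ultimately have "poly r a * poly r b < 0"
      by (auto simp: sgn_if mult_less_0_iff split: if_splits)
    then show ?thesis using poly_IVT[OF ab'(3)] by (auto simp: Y_def real_zeros_def)
  qed
  have "Y \<noteq> {}" using cards by auto
  have first: "\<exists>y\<in>Y. \<forall>x\<in>X. y < x"
  proof (cases "X = {}")
    case True
    then show ?thesis using \<open>Y \<noteq> {}\<close> by blast
  next
    case False
    define m where "m = Min X"
    have m: "m \<in> X" "\<And>x. x \<in> X \<Longrightarrow> m \<le> x" using fin False by (auto simp: m_def)
    obtain a where a: "a < m" "\<And>y. a < y \<Longrightarrow> y < m \<Longrightarrow> sgn (poly q y) = - sgn (poly r m)"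
      using sides[OF m(1)] by blast
    have "\<exists>y<m. poly r y = 0"
    proof (rule ccontr)
      assume no: "\<not> (\<exists>y<m. poly r y = 0)"
      obtain y where y: "a < y" "y < m" using dense a by blast
      have qnz: "poly q x \<noteq> 0" if "x < m" for x
        using m(2)[of x] that by (auto simp: X_def real_zeros_def)
      have "sgn (poly q y) = (- 1) ^ degree q * sgn (lead_coeff q)"
        by (rule sgn_poly_before[of m]) (use qnz y in auto)
      moreover have "sgn (poly r y) = (- 1) ^ degree r * sgn (lead_coeff r)"
        by (rule sgn_poly_before[of m]) (use no y in auto)
      moreover have "sgn (poly r y) = sgn (poly r m)"
        by (rule poly_same_sgn) (use no y sides[OF m(1)] in \<open>auto simp: order_class.order.order_iff_strict\<close>)
      ultimately have "sgn (poly r m) = 0"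
        using a(2)[OF y] deg lead by simp
      then show False using sides[OF m(1)] by (simp add: sgn_eq_0_iff)
    qed
    then show ?thesis using m by (force simp: Y_def real_zeros_def)
  qed
  have last: "\<exists>y\<in>Y. \<forall>x\<in>X. x < y"
  proof (cases "X = {}")
    case True
    then show ?thesis using \<open>Y \<noteq> {}\<close> by blast
  next
    case False
    define m where "m = Max X"
    have m: "m \<in> X" "\<And>x. x \<in> X \<Longrightarrow> x \<le> m" using fin False by (auto simp: m_def)
    obtain b where b: "b > m" "\<And>y. m < y \<Longrightarrow> y < b \<Longrightarrow> sgn (poly q y) = sgn (poly r m)"
      using sides[OF m(1)] by blast
    have "\<exists>y>m. poly r y = 0"
    proof (rule ccontr)
      assume no: "\<not> (\<exists>y>m. poly r y = 0)"
      obtain y where y: "m < y" "y < b" using dense b by blast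
      have qnz: "poly q x \<noteq> 0" if "x > m" for x
        using m(2)[of x] that by (auto simp: X_def real_zeros_def)
      have "sgn (poly q y) = sgn (lead_coeff q)"
        by (rule sgn_poly_beyond[of m]) (use qnz y in auto)
      moreover have "sgn (poly r y) = sgn (lead_coeff r)"
        by (rule sgn_poly_beyond[of m]) (use no y in auto)
      moreover have "sgn (poly r m) = sgn (poly r y)"
        by (rule poly_same_sgn) (use no y sides[OF m(1)] in \<open>auto simp: order_class.order.order_iff_strict\<close>)
      ultimately have "sgn (poly r m) = 0"
        using b(2)[OF y] lead by simp
      then show False using sides[OF m(1)] by (simp add: sgn_eq_0_iff)
    qed
    then show ?thesis using m by (force simp: Y_def real_zeros_def)
  qed
  \<comment> \<open>With the artificial end points lo and hi the zeros of q have as many gaps, all of them bounded, as r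
    has zeros, so that the uniqueness of the point in each gap applies to the zeros of r.\<close>
  define lo where "lo = Min (X \<union> Y) - 1"
  define hi where "hi = Max (X \<union> Y) + 1"
  have lo: "lo < x" if "x \<in> X \<union> Y" for x
    using Min_le[OF finite_UnI[OF fin(2,3)] that] unfolding lo_def by linarith
  have hi: "x < hi" if "x \<in> X \<union> Y" for x
    using Max_ge[OF finite_UnI[OF fin(2,3)] that] unfolding hi_def by linarith
  define X' where "X' = insert lo (insert hi X)"
  obtain y0 where "y0 \<in> Y" using \<open>Y \<noteq> {}\<close> by blast
  then have "lo < hi" using lo[of y0] hi[of y0] by auto
  have X': "finite X'" "card X' = Suc (card Y)"
  proof -
    have "lo \<notin> insert hi X" "hi \<notin> X" using lo[of lo] hi[of hi] \<open>lo < hi\<close> by auto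
    then show "finite X'" "card X' = Suc (card Y)" using fin cards by (auto simp: X'_def)
  qed
  have gapsX': "\<exists>y\<in>Y. a < y \<and> y < b" if ab: "consecutive X' a b" for a b
  proof -
    have cases: "a = lo \<or> a \<in> X" "b = hi \<or> b \<in> X"
    proof -
      have "a \<noteq> hi" "b \<noteq> lo"
        using ab lo[of b] hi[of b] lo[of a] hi[of a] \<open>lo < hi\<close> by (auto simp: consecutive_def X'_def)
      then show "a = lo \<or> a \<in> X" "b = hi \<or> b \<in> X"
        using ab by (auto simp: consecutive_def X'_def)
    qed
    show ?thesis
    proof (cases "a \<in> X \<and> b \<in> X")
      case True
      then have "consecutive X a b" using ab by (auto simp: consecutive_def X'_def)
      then show ?thesis by (rule betweenX)
    next
      case False
      then consider "a = lo" | "b = hi" "a \<in> X" using cases by blast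
      then show ?thesis
      proof cases
        case 1
        obtain y where "y \<in> Y" "\<forall>x\<in>X. y < x" using first by blast
        then show ?thesis using 1 cases(2) lo[of y] hi[of y] by (intro bexI[of _ y]) auto
      next
        case 2
        obtain y where "y \<in> Y" "\<forall>x\<in>X. x < y" using last by blast
        then show ?thesis using 2 hi[of y] by (intro bexI[of _ y]) auto
      qed
    qed
  qed
  have betweenY: "\<exists>x\<in>X. a < x \<and> x < b" if ab: "consecutive Y a b" for a b
  proof -
    have ab': "a \<in> Y" "b \<in> Y" "a < b" using ab by (auto simp: consecutive_def)
    obtain l u where lu: "consecutive X' l u" "Y \<inter> {l<..<u} = {a}"
      using gap_unique[OF X'(1) fin(3) X'(2) gapsX' ab'(1)] by blast
    have "l < a" "a < u" using lu by auto
    have "u \<le> b"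
    proof (rule ccontr)
      assume "\<not> u \<le> b"
      then have "b \<in> Y \<inter> {l<..<u}" using ab' \<open>l < a\<close> by auto
      then show False using lu ab' by auto
    qed
    then have "u \<noteq> hi" "u \<noteq> lo" using hi[of b] lo[of a] ab' \<open>a < u\<close> by auto
    then have "u \<in> X" using lu by (auto simp: consecutive_def X'_def)
    moreover from this have "u \<noteq> b" using disj ab' by auto
    ultimately show ?thesis using \<open>u \<le> b\<close> \<open>a < u\<close> by auto
  qed
  have "X \<noteq> {} \<longrightarrow> Min Y < Min X"
  proof
    assume "X \<noteq> {}"
    then obtain y where "y \<in> Y" "y < Min X" using first fin by (metis Min_in)
    then show "Min Y < Min X" using Min_le[OF fin(3) \<open>y \<in> Y\<close>] by linarith
  qed
  moreover have "Y - Y \<inter> X = Y" "X - Y \<inter> X = X" using disj by blast+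
  ultimately show ?thesis
    unfolding interlaces_def Let_def strictly_interlaces_def
    using fin \<open>Y \<noteq> {}\<close> betweenX betweenY by simp
qed

section \<open>Counting real and non-real zeros\<close>

abbreviation cpoly :: "real poly \<Rightarrow> complex poly" where
  "cpoly \<equiv> map_poly complex_of_real"

lemma cpoly_add: "cpoly (p + q) = cpoly p + cpoly q"
  by (rule poly_eqI) (simp add: coeff_map_poly)

lemma cpoly_minus: "cpoly (p - q) = cpoly p - cpoly q"
  by (rule poly_eqI) (simp add: coeff_map_poly)

lemma cpoly_smult: "cpoly (smult c p) = smult (complex_of_real c) (cpoly p)"
  by (rule poly_eqI) (simp add: coeff_map_poly)

lemma cpoly_pCons: "cpoly (pCons c p) = pCons (complex_of_real c) (cpoly p)"
  by (simp add: map_poly_pCons)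

lemma cpoly_mult: "cpoly (p * q) = cpoly p * cpoly q"
  by (rule poly_eqI) (simp add: coeff_map_poly coeff_mult)

lemma cpoly_power: "cpoly (p ^ n) = cpoly p ^ n"
  by (induction n) (simp_all add: cpoly_mult)

lemma cpoly_pderiv: "cpoly (pderiv p) = pderiv (cpoly p)"
  by (rule poly_eqI) (simp add: coeff_map_poly coeff_pderiv)

lemma cpoly_sum: "cpoly (\<Sum>i\<in>A. f i) = (\<Sum>i\<in>A. cpoly (f i))"
  by (induction A rule: infinite_finite_induct) (simp_all add: cpoly_add)

lemma degree_cpoly [simp]: "degree (cpoly p) = degree p"
  by (rule degree_map_poly) simp

lemma cpoly_eq_0_iff [simp]: "cpoly p = 0 \<longleftrightarrow> p = 0"
  by (rule map_poly_eq_0_iff) auto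

lemma poly_cpoly_of_real: "poly (cpoly p) (complex_of_real x) = complex_of_real (poly p x)"
  by (induction p) (simp_all add: cpoly_pCons)

lemma order_cpoly:
  assumes "p \<noteq> 0"
  shows "order (complex_of_real x) (cpoly p) = order x p"
proof -
  obtain q where q: "p = [:- x, 1:] ^ order x p * q" "\<not> [:- x, 1:] dvd q"
    using order_decomp[OF assms] by blast
  have "q \<noteq> 0" using q(1) assms by auto
  have "poly q x \<noteq> 0" using q(2) by (simp add: poly_eq_0_iff_dvd)
  then have "order (complex_of_real x) (cpoly q) = 0"
    by (intro order_0I) (simp add: poly_cpoly_of_real)
  moreover have "cpoly p = [:- complex_of_real x, 1:] ^ order x p * cpoly q"
    by (subst q(1)) (simp add: cpoly_mult cpoly_power cpoly_pCons)
  ultimately show ?thesis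
    using \<open>q \<noteq> 0\<close> by (simp add: order_mult order_power_n_n)
qed

text \<open>The real zeros of the complexified polynomial are those of the real one, with the same
  multiplicities, and over the complex numbers the zeros exhaust the degree.\<close>

lemma num_nonreal_zeros_plus_size_proots:
  assumes "p \<noteq> 0"
  shows "num_nonreal_zeros p + size (proots p) = degree p"
proof -
  have "{#z \<in># proots (cpoly p). z \<in> \<real>#} = image_mset complex_of_real (proots p)"
  proof (rule multiset_eqI)
    fix z :: complex
    show "count {#z \<in># proots (cpoly p). z \<in> \<real>#} z = count (image_mset complex_of_real (proots p)) z"
    proof (cases "z \<in> \<real>")
      case True
      then obtain x where x: "z = complex_of_real x" by (auto elim: Reals_cases)
      have "count (image_mset complex_of_real (proots p)) z = count (proots p) x"
      proof -
        have "complex_of_real -` {z} = {x}" by (auto simp: x)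
        then show ?thesis
          by (cases "x \<in># proots p") (simp_all add: count_image_mset count_eq_zero_iff del: count_proots)
      qed
      then show ?thesis using assms by (simp add: x order_cpoly)
    next
      case False
      then have "z \<notin># image_mset complex_of_real (proots p)" by auto
      then have "count (image_mset complex_of_real (proots p)) z = 0"
        by (simp only: count_eq_zero_iff not_False_eq_True)
      then show ?thesis using False by simp
    qed
  qed
  then have "size {#z \<in># proots (cpoly p). z \<in> \<real>#} = size (proots p)" by simp
  moreover have "size (proots (cpoly p)) =
      size {#z \<in># proots (cpoly p). z \<in> \<real>#} + size {#z \<in># proots (cpoly p). z \<notin> \<real>#}"
    by (subst multiset_partition[of "proots (cpoly p)" "\<lambda>z. z \<in> \<real>"]) (simp only: size_union)
  ultimately show ?thesis
    by (simp add: num_nonreal_zeros_def size_proots_complex)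
qed

lemma num_nonreal_zeros_eq_sum:
  assumes "p \<noteq> 0"
  shows "num_nonreal_zeros p = (\<Sum>z | z \<notin> \<real> \<and> poly (cpoly p) z = 0. order z (cpoly p))"
proof -
  have "set_mset {#z \<in># proots (cpoly p). z \<notin> \<real>#} = {z. z \<notin> \<real> \<and> poly (cpoly p) z = 0}"
    using assms by auto
  then show ?thesis
    using assms unfolding num_nonreal_zeros_def size_multiset_overloaded_eq
    by (intro sum.cong) auto
qed

lemma size_proots_eq_sum:
  fixes p :: "real poly"
  assumes "p \<noteq> 0"
  shows "size (proots p) = (\<Sum>x\<in>real_zeros p. order x p)"
  using assms by (simp add: size_multiset_overloaded_eq real_zeros_def)

text \<open>Distinct zeros are bounded from below and zeros with multiplicity from above by the same number,
  so nothing is left for multiplicities greater than one.\<close>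

lemma simple_zeros_from_bounds:
  fixes p :: "real poly"
  assumes "poly p 0 \<noteq> 0"
    and "k \<le> card {x. x > 0 \<and> poly p x = 0}" "l \<le> card {x. x < 0 \<and> poly p x = 0}"
    and "size (proots p) \<le> k + l"
  shows "has_simple_real_zeros p (k + l) l"
proof -
  have "p \<noteq> 0" using assms(1) by auto
  then have fin: "finite (real_zeros p)"
    by (simp add: real_zeros_def poly_roots_finite)
  have split: "real_zeros p = {x. x > 0 \<and> poly p x = 0} \<union> {x. x < 0 \<and> poly p x = 0}"
    using assms(1) by (auto simp: real_zeros_def) (metis linorder_neqE_linordered_idom)
  have card: "card (real_zeros p) = card {x. x > 0 \<and> poly p x = 0} + card {x. x < 0 \<and> poly p x = 0}"
  proof -
    have "finite {x. x > 0 \<and> poly p x = 0}" "finite {x. x < 0 \<and> poly p x = 0}"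
      by (rule finite_subset[OF _ fin]; force simp: real_zeros_def)+
    then show ?thesis unfolding split by (intro card_Un_disjoint) auto
  qed
  have ge1: "order x p \<ge> 1" if "x \<in> real_zeros p" for x
    using that \<open>p \<noteq> 0\<close> order_gt_0_iff[of p x] by (simp add: real_zeros_def)
  have sum: "(\<Sum>x\<in>real_zeros p. order x p) \<le> k + l"
    using assms(4) size_proots_eq_sum[OF \<open>p \<noteq> 0\<close>] by simp
  have "card (real_zeros p) \<le> (\<Sum>x\<in>real_zeros p. order x p)"
    using sum_mono[of "real_zeros p" "\<lambda>_. 1" "\<lambda>x. order x p"] ge1 by simp
  then have cards: "card (real_zeros p) = k + l" "card {x. x < 0 \<and> poly p x = 0} = l"
    using sum card assms(2,3) by linarith+
  have "order x p = 1" if x: "x \<in> real_zeros p" for x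
  proof (rule ccontr)
    assume "order x p \<noteq> 1"
    then have "1 < order x p" using ge1[OF x] by simp
    then have "(\<Sum>x\<in>real_zeros p. 1) < (\<Sum>x\<in>real_zeros p. order x p)"
      using fin x ge1 by (intro sum_strict_mono_ex1) auto
    then show False using sum cards by simp
  qed
  moreover have "{x \<in> real_zeros p. x < 0} = {x. x < 0 \<and> poly p x = 0}"
    by (auto simp: real_zeros_def)
  ultimately show ?thesis
    using \<open>p \<noteq> 0\<close> cards by (simp add: has_simple_real_zeros_def)
qed

section \<open>Laguerre polynomials on the scale of their degree\<close>

text \<open>In terms of the zeros \<open>a\<close> the logarithmic derivative is \<open>\<Sum> 1 / (z - a)\<close>, its derivative is
  \<open>- \<Sum> 1 / (z - a)\<^sup>2\<close>, and \<open>\<bar>z - a\<bar> \<ge> \<bar>Im z\<bar>\<close> for real \<open>a\<close>.  The induction removes one zero at a time.\<close>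

lemma real_rooted_log_deriv_bounds:
  fixes p :: "complex poly"
  assumes "p \<noteq> 0" "\<And>z. poly p z = 0 \<Longrightarrow> z \<in> \<real>" "Im z \<noteq> 0"
  defines "G \<equiv> poly (pderiv p) z / poly p z"
  shows "poly p z \<noteq> 0 \<and> norm G \<le> degree p / \<bar>Im z\<bar> \<and> Im G * Im z \<le> 0 \<and>
         norm (poly (pderiv (pderiv p)) z / poly p z - G\<^sup>2) \<le> degree p / (Im z)\<^sup>2"
  using assms(1,2) unfolding G_def
proof (induction "degree p" arbitrary: p)
  case 0
  then obtain c where "p = [:c:]" by (metis degree_eq_zeroE)
  then show ?case using 0 by simp
next
  case (Suc n)
  obtain a where "poly p a = 0"
    using alg_closed_imp_poly_has_root[of p] Suc.hyps(2) by auto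
  then obtain p1 where p1: "p = [:- a, 1:] * p1" by (metis dvdE poly_eq_0_iff_dvd)
  obtain b where b: "a = complex_of_real b" using Suc.prems(2)[OF \<open>poly p a = 0\<close>] by (auto elim: Reals_cases)
  have "p1 \<noteq> 0" using Suc.prems(1) p1 by auto
  have deg: "degree p = Suc (degree p1)" unfolding p1 using \<open>p1 \<noteq> 0\<close> by (subst degree_mult_eq) auto
  define A where "A = poly p1 z"
  define B where "B = poly (pderiv p1) z"
  define C where "C = poly (pderiv (pderiv p1)) z"
  have IH: "A \<noteq> 0" "norm (B / A) \<le> degree p1 / \<bar>Im z\<bar>" "Im (B / A) * Im z \<le> 0"
    "norm (C / A - (B / A)\<^sup>2) \<le> degree p1 / (Im z)\<^sup>2"
    using Suc.hyps(1)[of p1] Suc.hyps(2) deg \<open>p1 \<noteq> 0\<close> Suc.prems(2)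
    by (auto simp: A_def B_def C_def p1)
  have za: "z - a \<noteq> 0" using assms(3) b by auto
  have zero: "poly p z = (z - a) * A" unfolding p1 A_def by (simp add: algebra_simps)
  have lin: "pderiv [:- a, 1:] = 1" by (simp add: pderiv_pCons)
  have d1: "pderiv p = p1 + [:- a, 1:] * pderiv p1"
    unfolding p1 pderiv_mult lin by simp
  have d2: "pderiv (pderiv p) = pderiv p1 + pderiv p1 + [:- a, 1:] * pderiv (pderiv p1)"
    unfolding d1 pderiv_add pderiv_mult lin by simp
  have one: "poly (pderiv p) z = A + (z - a) * B"
    unfolding d1 A_def B_def by (simp add: algebra_simps)
  have two: "poly (pderiv (pderiv p)) z = 2 * B + (z - a) * C"
    unfolding d2 B_def C_def by (simp add: algebra_simps)
  have log1: "poly (pderiv p) z / poly p z = 1 / (z - a) + B / A"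
    unfolding zero one using za IH(1) by (simp add: field_simps)
  have log2: "poly (pderiv (pderiv p)) z / poly p z - (1 / (z - a) + B / A)\<^sup>2
        = (C / A - (B / A)\<^sup>2) - 1 / (z - a)\<^sup>2"
  proof -
    have "(2 * B + w * C) / (w * A) - (1 / w + B / A)\<^sup>2 = (C / A - (B / A)\<^sup>2) - 1 / w\<^sup>2"
      if "w \<noteq> 0" for w :: complex
      using that IH(1) by (simp add: field_simps power2_eq_square)
    from this[OF za] show ?thesis unfolding zero two .
  qed
  have Im_le: "\<bar>Im z\<bar> \<le> norm (z - a)"
    using abs_Im_le_cmod[of "z - a"] b by simp
  have n1: "norm (1 / (z - a)) \<le> 1 / \<bar>Im z\<bar>"
    using Im_le assms(3) za by (simp add: norm_divide frac_le)
  have n2: "norm (1 / (z - a)\<^sup>2) \<le> 1 / (Im z)\<^sup>2"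
    using power_mono[OF n1, of 2] by (simp add: norm_divide norm_power power_divide)
  have n3: "Im (1 / (z - a)) * Im z \<le> 0"
    using b by (simp add: Im_divide divide_nonpos_nonneg power2_eq_square)
  have r: "real (degree p) = 1 + real (degree p1)" using deg by simp
  show ?case
  proof (intro conjI)
    show "poly p z \<noteq> 0" using zero za IH(1) by simp
    show "norm (poly (pderiv p) z / poly p z) \<le> degree p / \<bar>Im z\<bar>"
      unfolding log1 r add_divide_distrib by (rule order.trans[OF norm_triangle_ineq]) (use n1 IH(2) in linarith)
    show "Im (poly (pderiv p) z / poly p z) * Im z \<le> 0"
      unfolding log1 plus_complex.sel distrib_right using n3 IH(3) by linarith
    show "norm (poly (pderiv (pderiv p)) z / poly p z - (poly (pderiv p) z / poly p z)\<^sup>2)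
        \<le> degree p / (Im z)\<^sup>2"
      unfolding log1 log2 r add_divide_distrib
      by (rule order.trans[OF norm_triangle_ineq4]) (use n2 IH(4) in linarith)
  qed
qed

lemma coeff_nlaguerre:
  assumes "\<alpha> > -1"
  shows "coeff (nlaguerre \<alpha> n) j = real (n choose j) * (- 1) ^ j / pochhammer (1 + \<alpha>) j"
  by (simp add: nlaguerre_eq_lag_transform[OF assms] coeff_lag_transform coeff_one_plus_X_power)

lemma Suc_times_choose_Suc:
  "real (Suc j) * real (n choose Suc j) = (real n - real j) * real (n choose j)"
proof (cases "j \<le> n")
  case True
  have "Suc j * (n choose Suc j) = (n - j) * (n choose j)"
    using binomial_absorb_comp[of n j] Suc_times_binomial_eq[of "n - 1" j] by (cases n) (auto simp: mult_ac)
  then have "real (Suc j * (n choose Suc j)) = real ((n - j) * (n choose j))" by (simp only:)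
  then show ?thesis using True by (simp only: of_nat_mult of_nat_diff)
qed (simp add: binomial_eq_0)

lemma card_set_mset_le_size: "card (set_mset M) \<le> size M"
proof -
  have "(\<Sum>x\<in>set_mset M. 1) \<le> (\<Sum>x\<in>set_mset M. count M x)"
    by (rule sum_mono) simp
  then show ?thesis by (simp add: size_multiset_overloaded_eq)
qed

lemma nlaguerre_ode:
  fixes n :: nat
  assumes "\<alpha> > -1"
  defines "y \<equiv> nlaguerre \<alpha> n"
  shows "pCons 0 (pderiv (pderiv y)) + smult (\<alpha> + 1) (pderiv y) - pCons 0 (pderiv y) + smult (real n) y = 0"
proof (rule poly_eqI)
  fix j
  have rec: "real (Suc j) * (1 + \<alpha> + real j) * coeff y (Suc j) = (real j - real n) * coeff y j"
  proof -
    have p: "pochhammer (1 + \<alpha>) j > 0" "1 + \<alpha> + real j > 0" using pochhammer_pos_shift[OF assms(1)] assms(1) by auto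
    note b = Suc_times_choose_Suc[of j n]
    have "real (Suc j) * (1 + \<alpha> + real j) * coeff y (Suc j) =
        (1 + \<alpha> + real j) * (real (Suc j) * real (n choose Suc j)) * (- 1) ^ Suc j / (pochhammer (1 + \<alpha>) j * (1 + \<alpha> + real j))"
      unfolding y_def coeff_nlaguerre[OF assms(1)] pochhammer_Suc by simp
    also have "\<dots> = (real j - real n) * coeff y j"
    proof -
      have "s * ((N - J) * B) * (- e) / (Q * s) = (J - N) * (B * e / Q)"
        if "s > 0" "Q > 0" for s N J B e Q :: real
        using that by (simp add: field_simps)
      from this[OF p(2) p(1)] show ?thesis
        unfolding b y_def coeff_nlaguerre[OF assms(1)] by simp
    qed
    finally show ?thesis .
  qed
  have "coeff (pCons 0 (pderiv (pderiv y)) + smult (\<alpha> + 1) (pderiv y) - pCons 0 (pderiv y) + smult (real n) y) j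
      = real (Suc j) * (1 + \<alpha> + real j) * coeff y (Suc j) - (real j - real n) * coeff y j"
    by (cases j) (simp_all add: coeff_pderiv algebra_simps)
  then show "coeff (pCons 0 (pderiv (pderiv y)) + smult (\<alpha> + 1) (pderiv y) - pCons 0 (pderiv y) + smult (real n) y) j
      = coeff 0 j"
    using rec by simp
qed

lemma nlaguerre_raise:
  assumes "\<alpha> > -1"
  shows "smult (real n + 1 + \<alpha>) (nlaguerre \<alpha> (Suc n)) =
      smult (real n + 1 + \<alpha>) (nlaguerre \<alpha> n) - pCons 0 (nlaguerre \<alpha> n) + pCons 0 (pderiv (nlaguerre \<alpha> n))"
proof (rule poly_eqI)
  fix j
  show "coeff (smult (real n + 1 + \<alpha>) (nlaguerre \<alpha> (Suc n))) j = coeff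
      (smult (real n + 1 + \<alpha>) (nlaguerre \<alpha> n) - pCons 0 (nlaguerre \<alpha> n) + pCons 0 (pderiv (nlaguerre \<alpha> n))) j"
  proof (cases j)
    case 0
    then show ?thesis by (simp add: coeff_nlaguerre[OF assms])
  next
    case (Suc i)
    have p: "pochhammer (1 + \<alpha>) i > 0" "1 + \<alpha> + real i > 0" using pochhammer_pos_shift[OF assms] assms by auto
    note b = Suc_times_choose_Suc[of i n]
    define X where "X = real (n choose i)"
    define Y where "Y = real (n choose Suc i)"
    define Q where "Q = pochhammer (1 + \<alpha>) i"
    have key: "(real n + 1 + \<alpha>) * (X + Y) = (real n + 1 + \<alpha> + real (Suc i)) * Y + (1 + \<alpha> + real i) * X"
      using b by (simp add: X_def Y_def algebra_simps)
    have c1: "coeff (smult (real n + 1 + \<alpha>) (nlaguerre \<alpha> (Suc n))) j =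
        (real n + 1 + \<alpha>) * (X + Y) * (- 1) ^ Suc i / (Q * (1 + \<alpha> + real i))"
      by (simp add: Suc coeff_nlaguerre[OF assms] X_def Y_def Q_def pochhammer_Suc)
    have c2: "coeff (smult (real n + 1 + \<alpha>) (nlaguerre \<alpha> n) - pCons 0 (nlaguerre \<alpha> n) + pCons 0 (pderiv (nlaguerre \<alpha> n))) j =
        (real n + 1 + \<alpha> + real (Suc i)) * (Y * (- 1) ^ Suc i / (Q * (1 + \<alpha> + real i))) - X * (- 1) ^ i / Q"
    proof -
      define W where "W = coeff (nlaguerre \<alpha> n) (Suc i)"
      define V where "V = coeff (nlaguerre \<alpha> n) i"
      have "coeff (smult (real n + 1 + \<alpha>) (nlaguerre \<alpha> n) - pCons 0 (nlaguerre \<alpha> n) +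
          pCons 0 (pderiv (nlaguerre \<alpha> n))) j = (real n + 1 + \<alpha> + real (Suc i)) * W - V"
        by (simp add: Suc W_def[symmetric] V_def[symmetric] coeff_pderiv algebra_simps)
      moreover have "W = Y * (- 1) ^ Suc i / (Q * (1 + \<alpha> + real i))" "V = X * (- 1) ^ i / Q"
        by (simp_all add: W_def V_def coeff_nlaguerre[OF assms] X_def Y_def Q_def pochhammer_Suc)
      ultimately show ?thesis by simp
    qed
    show ?thesis
    proof -
      have "(u * y + s * x) * (- e) / (q * s) = u * (y * (- e) / (q * s)) - x * e / q"
        if "s > 0" "q > 0" for u y s x e q :: real
        using that by (simp add: field_simps)
      from this[OF p(2) p(1)] show ?thesis unfolding c1 c2 key Q_def by simp
    qed
  qed
qed

lemma nlaguerre_lower_degree: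
  assumes "\<alpha> > -1"
  shows "smult (real (Suc n)) (nlaguerre \<alpha> n) =
      smult (real (Suc n)) (nlaguerre \<alpha> (Suc n)) - pCons 0 (pderiv (nlaguerre \<alpha> (Suc n)))"
proof (rule poly_eqI)
  fix j
  have b: "real (Suc n) * real (n choose j) = (real (Suc n) - real j) * real (Suc n choose j)"
  proof (cases "j \<le> Suc n")
    case True
    have "Suc n * (n choose j) = (Suc n - j) * (Suc n choose j)"
      using binomial_absorb_comp[of "Suc n" j] by simp
    then have "real (Suc n * (n choose j)) = real ((Suc n - j) * (Suc n choose j))" by (simp only:)
    then show ?thesis using True by (simp only: of_nat_mult of_nat_diff)
  qed (simp add: binomial_eq_0)
  have "coeff (smult (real (Suc n)) (nlaguerre \<alpha> n)) j =
      real (Suc n) * real (n choose j) * (- 1) ^ j / pochhammer (1 + \<alpha>) j"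
    by (simp add: coeff_nlaguerre[OF assms])
  also have "\<dots> = (real (Suc n) - real j) * coeff (nlaguerre \<alpha> (Suc n)) j"
    unfolding b by (simp only: coeff_nlaguerre[OF assms]) simp
  also have "\<dots> = coeff (smult (real (Suc n)) (nlaguerre \<alpha> (Suc n)) - pCons 0 (pderiv (nlaguerre \<alpha> (Suc n)))) j"
    by (cases j) (simp_all add: coeff_pderiv algebra_simps)
  finally show "coeff (smult (real (Suc n)) (nlaguerre \<alpha> n)) j = coeff
      (smult (real (Suc n)) (nlaguerre \<alpha> (Suc n)) - pCons 0 (pderiv (nlaguerre \<alpha> (Suc n)))) j" .
qed

lemma nlaguerre_nonzero: "\<alpha> > -1 \<Longrightarrow> nlaguerre \<alpha> n \<noteq> 0"
  by (simp add: nlaguerre_eq_lag_transform lag_transform_eq_0_iff)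

lemma degree_nlaguerre: "\<alpha> > -1 \<Longrightarrow> degree (nlaguerre \<alpha> n) = n"
  by (simp add: nlaguerre_eq_lag_transform degree_lag_transform degree_power_eq)

text \<open>All \<open>n\<close> zeros of \<open>(1 + y)^n\<close> are negative, so Rolle's theorem already provides \<open>n\<close> positive zeros.\<close>

lemma nlaguerre_real_rooted:
  assumes "\<alpha> > -1" "poly (cpoly (nlaguerre \<alpha> n)) z = 0"
  shows "z \<in> \<real>"
proof (rule ccontr)
  assume "z \<notin> \<real>"
  let ?p = "nlaguerre \<alpha> n"
  let ?A = "{x. x > 0 \<and> poly ?p x = 0}"
  have "proots ([:1, 1::real:] ^ n) = replicate_mset n (-1)"
    by (simp add: proots_power)
  moreover have "size {#x \<in># replicate_mset n (-1::real). x < 0#} = n"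
    by (induction n) auto
  ultimately have "n \<le> card ?A"
    using lag_transform_zeros_ge[of \<alpha> "[:1, 1:] ^ n"] assms(1) by (simp add: nlaguerre_eq_lag_transform)
  moreover have "card ?A \<le> size (proots ?p)"
  proof -
    have "?A \<subseteq> set_mset (proots ?p)" using nlaguerre_nonzero[OF assms(1)] by auto
    then have "card ?A \<le> card (set_mset (proots ?p))" by (intro card_mono) auto
    also have "\<dots> \<le> size (proots ?p)" by (rule card_set_mset_le_size)
    finally show ?thesis .
  qed
  ultimately have "num_nonreal_zeros ?p = 0"
    using num_nonreal_zeros_plus_size_proots[OF nlaguerre_nonzero[OF assms(1), of n]]
    by (simp add: degree_nlaguerre[OF assms(1)])
  then have "{#w \<in># proots (cpoly ?p). w \<notin> \<real>#} = {#}"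
    by (simp add: num_nonreal_zeros_def)
  moreover have "z \<in># {#w \<in># proots (cpoly ?p). w \<notin> \<real>#}"
    using assms(2) \<open>z \<notin> \<real>\<close> nlaguerre_nonzero[OF assms(1)] by simp
  ultimately show False by (simp only: set_mset_empty empty_iff)
qed

definition scaled_log_deriv :: "real \<Rightarrow> nat \<Rightarrow> complex \<Rightarrow> complex" where
  "scaled_log_deriv \<alpha> n t =
     poly (pderiv (cpoly (nlaguerre \<alpha> n))) (of_nat n * t) / poly (cpoly (nlaguerre \<alpha> n)) (of_nat n * t)"

text \<open>The root of \<open>t g\<^sup>2 - t g + 1 = 0\<close> whose imaginary part has the sign opposite to that of \<open>Im t\<close>; the
  other root has \<open>+ csqrt\<close>.\<close>

definition log_deriv_limit :: "complex \<Rightarrow> complex" where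
  "log_deriv_limit t = (1 - csqrt (1 - 4 / t)) / 2"

text \<open>The square of the root has the imaginary part \<open>4 Im t / \<bar>t\<bar>\<^sup>2\<close>, and the principal root has a
  non-negative real part.\<close>

lemma Im_csqrt_sgn:
  assumes "Im t \<noteq> 0"
  shows "Im (csqrt (1 - 4 / t)) * Im t > 0"
proof -
  define c where "c = csqrt (1 - 4 / t)"
  have "Im (c\<^sup>2) = 4 * Im t / (cmod t)\<^sup>2"
    by (simp add: c_def Im_divide cmod_power2)
  then have eq: "2 * Re c * Im c = 4 * Im t / (cmod t)\<^sup>2"
    by (simp add: power2_eq_square mult_ac)
  have "cmod t > 0" using assms by auto
  then have "(2 * Re c * Im c) * Im t > 0"
    unfolding eq using assms by (simp add: zero_less_mult_iff zero_less_divide_iff) linarith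
  moreover have "Re c \<ge> 0"
    unfolding c_def using csqrt_principal[of "1 - 4 / t"] by linarith
  ultimately show ?thesis
    unfolding c_def[symmetric] by (auto simp: zero_less_mult_iff mult_less_0_iff)
qed

lemma csqrt_arg_off_cut:
  assumes "Im t \<noteq> 0"
  shows "1 - 4 / t \<notin> \<real>\<^sub>\<le>\<^sub>0"
proof
  assume "1 - 4 / t \<in> \<real>\<^sub>\<le>\<^sub>0"
  then have "Im (1 - 4 / t) = 0" by (auto simp: complex_nonpos_Reals_iff)
  then show False using assms by (auto simp: Im_divide add_nonneg_eq_0_iff)
qed

lemma continuous_on_csqrt_arg:
  assumes "\<And>t. t \<in> S \<Longrightarrow> Im t \<noteq> 0"
  shows "continuous_on S (\<lambda>t. csqrt (1 - 4 / t))"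
proof -
  have range: "(\<lambda>t. 1 - 4 / t) ` S \<subseteq> - \<real>\<^sub>\<le>\<^sub>0"
    using csqrt_arg_off_cut assms by blast
  have "t \<noteq> 0" if "t \<in> S" for t using assms[OF that] by auto
  then have "continuous_on S (\<lambda>t. 1 - 4 / t)"
    by (intro continuous_on_diff continuous_on_divide continuous_on_const continuous_on_id) auto
  then show ?thesis
    by (rule continuous_on_compose2[OF continuous_on_csqrt _ range])
qed

text \<open>The Laguerre equation, divided by the polynomial and evaluated at \<open>n t\<close>, reads
  \<open>t (g - g\<^sub>1) (g - g\<^sub>2) = O(1 / n)\<close> with \<open>g\<^sub>1\<close> the claimed limit and \<open>g\<^sub>2\<close> the other root.  The imaginary
  parts of \<open>g\<close> and \<open>g\<^sub>2\<close> have opposite signs, so \<open>g - g\<^sub>2\<close> stays away from \<open>0\<close> and can be divided out.\<close>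

lemma scaled_log_deriv_bound:
  assumes "\<alpha> > -1" "n > 0" "Im t \<noteq> 0"
  shows "cmod (scaled_log_deriv \<alpha> n t - log_deriv_limit t) \<le>
    (cmod t / (Im t)\<^sup>2 + (\<alpha> + 1) / \<bar>Im t\<bar>) * (2 / (cmod t * \<bar>Im (csqrt (1 - 4 / t))\<bar>)) / real n"
proof -
  define p where "p = cpoly (nlaguerre \<alpha> n)"
  define z where "z = of_nat n * t"
  define g where "g = scaled_log_deriv \<alpha> n t"
  define D where "D = poly (pderiv (pderiv p)) z / poly p z - g\<^sup>2"
  define c where "c = csqrt (1 - 4 / t)"
  have Imz: "Im z = real n * Im t" by (simp add: z_def)
  have "p \<noteq> 0" using nlaguerre_nonzero[OF assms(1)] by (simp add: p_def)
  have bounds: "poly p z \<noteq> 0" "cmod g \<le> real n / \<bar>Im z\<bar>" "Im g * Im z \<le> 0" "cmod D \<le> real n / (Im z)\<^sup>2"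
    using real_rooted_log_deriv_bounds[OF \<open>p \<noteq> 0\<close>, of z] nlaguerre_real_rooted[OF assms(1), of n] Imz assms
    by (auto simp: p_def g_def scaled_log_deriv_def z_def D_def degree_nlaguerre)
  have g_le: "cmod g \<le> 1 / \<bar>Im t\<bar>"
    using bounds(2) assms(2) by (simp add: Imz abs_mult)
  have D_le: "cmod D \<le> 1 / (Im t)\<^sup>2 / real n"
    using bounds(4) assms(2) by (simp add: Imz power2_eq_square field_simps)
  have Img: "Im g * Im t \<le> 0"
    using bounds(3) assms(2) by (simp add: Imz mult_le_0_iff zero_le_mult_iff)
  have "poly (cpoly (pCons 0 (pderiv (pderiv (nlaguerre \<alpha> n))) + smult (\<alpha> + 1) (pderiv (nlaguerre \<alpha> n)) -
      pCons 0 (pderiv (nlaguerre \<alpha> n)) + smult (real n) (nlaguerre \<alpha> n))) z = 0"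
    unfolding nlaguerre_ode[OF assms(1)] by simp
  then have "z * poly (pderiv (pderiv p)) z + (of_real \<alpha> + 1 - z) * poly (pderiv p) z + of_nat n * poly p z = 0"
    by (simp add: cpoly_add cpoly_minus cpoly_smult cpoly_pCons cpoly_pderiv p_def algebra_simps)
  then have "(z * poly (pderiv (pderiv p)) z + (of_real \<alpha> + 1 - z) * poly (pderiv p) z + of_nat n * poly p z) / poly p z = 0"
    by simp
  then have "z * (poly (pderiv (pderiv p)) z / poly p z) + (of_real \<alpha> + 1 - z) * g + of_nat n = 0"
    using bounds(1) by (simp add: add_divide_distrib g_def scaled_log_deriv_def p_def z_def)
  then have "z * (D + g\<^sup>2) + (of_real \<alpha> + 1 - z) * g + of_nat n = 0"
    by (simp add: D_def)
  then have "of_nat n * (t * g\<^sup>2 - t * g + 1) = - (of_nat n * t * D + (of_real \<alpha> + 1) * g)"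
    by (simp add: z_def algebra_simps add_eq_0_iff)
  then have quad: "t * g\<^sup>2 - t * g + 1 = - (t * D + (of_real \<alpha> + 1) * g / of_nat n)"
    using assms(2) by (simp add: field_simps)
  have "t \<noteq> 0" using assms(3) by auto
  have c2: "c\<^sup>2 = 1 - 4 / t" by (simp add: c_def)
  have "t * (g - (1 - c) / 2) * (g - (1 + c) / 2) = t * g\<^sup>2 - t * g + t * (1 - c\<^sup>2) / 4"
    by (simp add: field_simps power2_eq_square)
  also have "t * (1 - c\<^sup>2) / 4 = 1" unfolding c2 using \<open>t \<noteq> 0\<close> by simp
  finally have fac: "t * (g - (1 - c) / 2) * (g - (1 + c) / 2) = - (t * D + (of_real \<alpha> + 1) * g / of_nat n)"
    using quad by simp
  have "cmod (t * D + (of_real \<alpha> + 1) * g / of_nat n) \<le> cmod t * cmod D + (\<alpha> + 1) * cmod g / real n"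
  proof (rule order.trans[OF norm_triangle_ineq])
    have "cmod (of_real \<alpha> + 1) = \<alpha> + 1"
      using assms(1) norm_of_real[of "\<alpha> + 1", where ?'a = complex] by simp
    then show "cmod (t * D) + cmod ((of_real \<alpha> + 1) * g / of_nat n) \<le> cmod t * cmod D + (\<alpha> + 1) * cmod g / real n"
      by (simp add: norm_mult norm_divide)
  qed
  also have "\<dots> \<le> cmod t * (1 / (Im t)\<^sup>2 / real n) + (\<alpha> + 1) * (1 / \<bar>Im t\<bar>) / real n"
    by (intro add_mono mult_left_mono divide_right_mono D_le g_le) (use assms in auto)
  also have "\<dots> = (cmod t / (Im t)\<^sup>2 + (\<alpha> + 1) / \<bar>Im t\<bar>) / real n"
    by (simp add: add_divide_distrib)
  finally have up: "cmod t * cmod (g - (1 - c) / 2) * cmod (g - (1 + c) / 2) \<le>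
      (cmod t / (Im t)\<^sup>2 + (\<alpha> + 1) / \<bar>Im t\<bar>) / real n"
    using arg_cong[OF fac, of cmod] by (simp only: norm_mult norm_minus_cancel)
  have sgnc: "Im c * Im t > 0" using Im_csqrt_sgn[OF assms(3)] by (simp add: c_def)
  have "\<bar>Im c\<bar> / 2 \<le> \<bar>Im (g - (1 + c) / 2)\<bar>"
    using sgnc Img by (auto simp: zero_less_mult_iff mult_le_0_iff abs_if)
  then have low: "\<bar>Im c\<bar> / 2 \<le> cmod (g - (1 + c) / 2)"
    using abs_Im_le_cmod[of "g - (1 + c) / 2"] by linarith
  have pos: "cmod t > 0" "\<bar>Im c\<bar> > 0" using \<open>t \<noteq> 0\<close> sgnc by auto
  have "cmod (g - (1 - c) / 2) * (cmod t * (\<bar>Im c\<bar> / 2)) \<le> cmod (g - (1 - c) / 2) * (cmod t * cmod (g - (1 + c) / 2))"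
    by (intro mult_left_mono low) auto
  also have "\<dots> \<le> (cmod t / (Im t)\<^sup>2 + (\<alpha> + 1) / \<bar>Im t\<bar>) / real n"
    using up by (simp add: mult_ac)
  finally have "cmod (g - (1 - c) / 2) \<le> (cmod t / (Im t)\<^sup>2 + (\<alpha> + 1) / \<bar>Im t\<bar>) / real n / (cmod t * (\<bar>Im c\<bar> / 2))"
    using pos by (subst pos_le_divide_eq) auto
  also have "\<dots> = (cmod t / (Im t)\<^sup>2 + (\<alpha> + 1) / \<bar>Im t\<bar>) * (2 / (cmod t * \<bar>Im c\<bar>)) / real n"
    by simp
  finally show ?thesis
    by (simp add: g_def c_def log_deriv_limit_def)
qed

lemma uniform_limit_scaled_log_deriv:
  assumes "\<alpha> > -1" "compact S" "\<And>t. t \<in> S \<Longrightarrow> Im t \<noteq> 0"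
  shows "uniform_limit S (scaled_log_deriv \<alpha>) log_deriv_limit sequentially"
proof -
  define M where "M = (\<lambda>t. (cmod t / (Im t)\<^sup>2 + (\<alpha> + 1) / \<bar>Im t\<bar>) * (2 / (cmod t * \<bar>Im (csqrt (1 - 4 / t))\<bar>)))"
  have "continuous_on S M"
  proof -
    define c where "c = (\<lambda>t. csqrt (1 - 4 / t))"
    have cont: "continuous_on S c"
      unfolding c_def by (rule continuous_on_csqrt_arg) (rule assms(3))
    have nz: "Im t \<noteq> 0" "t \<noteq> 0" "Im (c t) \<noteq> 0" if "t \<in> S" for t
      using assms(3)[OF that] Im_csqrt_sgn[of t] by (auto simp: c_def)
    show ?thesis
      unfolding M_def fun_cong[OF c_def, symmetric]
      by (intro continuous_intros cont) (use nz in auto)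
  qed
  then have "bounded (M ` S)"
    using assms(2) by (intro compact_imp_bounded compact_continuous_image)
  then obtain B where B: "\<And>t. t \<in> S \<Longrightarrow> \<bar>M t\<bar> \<le> B"
    by (auto simp: bounded_iff)
  have "uniform_limit S (\<lambda>n t. scaled_log_deriv \<alpha> n t - log_deriv_limit t) (\<lambda>_. 0) sequentially"
  proof (rule uniform_limit_null_comparison)
    show "\<forall>\<^sub>F n in sequentially. \<forall>t\<in>S. norm (scaled_log_deriv \<alpha> n t - log_deriv_limit t) \<le> B / real n"
      using eventually_gt_at_top[of 0]
    proof eventually_elim
      case (elim n)
      show ?case
      proof
        fix t assume t: "t \<in> S"
        have "norm (scaled_log_deriv \<alpha> n t - log_deriv_limit t) \<le> M t / real n"
          using scaled_log_deriv_bound[OF assms(1) elim assms(3)[OF t]] by (simp add: M_def)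
        also have "\<dots> \<le> B / real n"
          using B[OF t] by (intro divide_right_mono) auto
        finally show "norm (scaled_log_deriv \<alpha> n t - log_deriv_limit t) \<le> B / real n" .
      qed
    qed
    have "(\<lambda>n. B / real n) \<longlonglongrightarrow> 0" by real_asymp
    then show "uniform_limit S (\<lambda>n t. B / real n) (\<lambda>_. 0) sequentially"
      by (auto intro!: uniform_limitI dest: tendstoD)
  qed
  then show ?thesis
    by (simp add: uniform_limit_iff dist_norm)
qed

text \<open>The solution of \<open>\<psi> + 1 / \<psi> = 2 - t\<close> outside the closed unit disc, that is, the inverse of a shifted Joukowski map.
  It is the limit of the ratio of Laguerre polynomials of consecutive degrees.\<close>

definition joukowski_branch :: "complex \<Rightarrow> complex" where
  "joukowski_branch t = 1 - t * (1 + csqrt (1 - 4 / t)) / 2"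

lemma joukowski_branch_quadratic:
  assumes "t \<noteq> 0"
  shows "joukowski_branch t * joukowski_branch t = (2 - t) * joukowski_branch t - 1"
proof -
  define c where "c = csqrt (1 - 4 / t)"
  have "c\<^sup>2 = 1 - 4 / t" by (simp add: c_def)
  then have "t * (c * c) = t - 4" using assms by (simp add: power2_eq_square field_simps)
  then have "t * (t * (c * c)) = t * (t - 4)" by (simp only:)
  then have "t * t * (c * c) = t * t - 4 * t" by (simp add: algebra_simps)
  moreover have "(1 - t * (1 + c) / 2) * (1 - t * (1 + c) / 2) - ((2 - t) * (1 - t * (1 + c) / 2) - 1)
      = (t * t * (c * c) - (t * t - 4 * t)) / 4"
    by (simp add: field_simps)
  ultimately show ?thesis unfolding joukowski_branch_def c_def[symmetric] by simp
qed

lemma joukowski_branch_inverse: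
  assumes "t \<noteq> 0"
  shows "joukowski_branch t \<noteq> 0" "t = 2 - joukowski_branch t - 1 / joukowski_branch t"
proof -
  show nz: "joukowski_branch t \<noteq> 0" using joukowski_branch_quadratic[OF assms] by auto
  have "(2 - t) * joukowski_branch t = joukowski_branch t * joukowski_branch t + 1"
    using joukowski_branch_quadratic[OF assms] by simp
  then have "2 - t = joukowski_branch t + 1 / joukowski_branch t"
    using nz by (simp add: field_simps)
  then show "t = 2 - joukowski_branch t - 1 / joukowski_branch t" by (simp add: algebra_simps)
qed

text \<open>For \<open>t = 2 - \<zeta> - 1 / \<zeta>\<close> the number \<open>1 - 4 / t\<close> is the square of \<open>(\<zeta> + 1) / (\<zeta> - 1)\<close>, whose real part
  is positive exactly when \<open>\<bar>\<zeta>\<bar> > 1\<close>; so this is the principal root.\<close>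

lemma joukowski_branch_at:
  assumes "cmod \<zeta> > 1"
  shows "joukowski_branch (2 - \<zeta> - 1 / \<zeta>) = \<zeta>"
proof -
  define t where "t = 2 - \<zeta> - 1 / \<zeta>"
  define c where "c = (\<zeta> + 1) / (\<zeta> - 1)"
  have z: "\<zeta> \<noteq> 0" "\<zeta> - 1 \<noteq> 0" using assms by auto
  have t: "t = - ((\<zeta> - 1) * (\<zeta> - 1) / \<zeta>)" using z by (simp add: t_def field_simps)
  have "1 - 4 / t = 1 + 4 * \<zeta> / ((\<zeta> - 1) * (\<zeta> - 1))" using z by (simp add: t)
  also have "\<dots> = ((\<zeta> - 1) * (\<zeta> - 1) + 4 * \<zeta>) / ((\<zeta> - 1) * (\<zeta> - 1))"
    using z by (simp add: add_divide_distrib)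
  also have "(\<zeta> - 1) * (\<zeta> - 1) + 4 * \<zeta> = (\<zeta> + 1) * (\<zeta> + 1)" by (simp add: algebra_simps)
  also have "(\<zeta> + 1) * (\<zeta> + 1) / ((\<zeta> - 1) * (\<zeta> - 1)) = c\<^sup>2" by (simp add: c_def power2_eq_square)
  finally have c2: "c\<^sup>2 = 1 - 4 / t" by simp
  have "Re c = ((Re \<zeta> + 1) * (Re \<zeta> - 1) + Im \<zeta> * Im \<zeta>) / (cmod (\<zeta> - 1))\<^sup>2"
    by (simp add: c_def Re_divide cmod_power2)
  also have "(Re \<zeta> + 1) * (Re \<zeta> - 1) + Im \<zeta> * Im \<zeta> = (cmod \<zeta>)\<^sup>2 - 1"
    unfolding cmod_power2 by (simp add: power2_eq_square algebra_simps)
  finally have "Re c > 0"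
    using assms z by (simp add: zero_less_divide_iff one_less_power)
  then have "csqrt (1 - 4 / t) = c" using c2 by (intro csqrt_unique) auto
  then have "joukowski_branch t = 1 - t * (1 + c) / 2" by (simp add: joukowski_branch_def)
  also have "(1 + c) = 2 * \<zeta> / (\<zeta> - 1)" using z by (simp add: c_def field_simps)
  also have "1 - t * (2 * \<zeta> / (\<zeta> - 1)) / 2 = \<zeta>"
    unfolding t using z by (simp add: field_simps)
  finally show ?thesis by (simp add: t_def)
qed

lemma nlaguerre_recurrence:
  assumes "\<alpha> > -1"
  shows "smult (real (Suc n) + 1 + \<alpha>) (nlaguerre \<alpha> (Suc (Suc n))) =
     smult (2 * real (Suc n) + 1 + \<alpha>) (nlaguerre \<alpha> (Suc n)) - pCons 0 (nlaguerre \<alpha> (Suc n)) -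
     smult (real (Suc n)) (nlaguerre \<alpha> n)"
proof -
  have "pCons 0 (pderiv (nlaguerre \<alpha> (Suc n))) =
      smult (real (Suc n)) (nlaguerre \<alpha> (Suc n)) - smult (real (Suc n)) (nlaguerre \<alpha> n)"
    unfolding nlaguerre_lower_degree[OF assms, of n] by simp
  moreover have "smult (2 * real (Suc n) + 1 + \<alpha>) p = smult (real (Suc n) + 1 + \<alpha>) p + smult (real (Suc n)) p"
    for p :: "real poly"
    unfolding smult_add_left[symmetric] by (simp add: add_ac)
  ultimately show ?thesis
    unfolding nlaguerre_raise[OF assms, of "Suc n"] by (simp only: algebra_simps)
qed

definition scaled_ratio :: "real \<Rightarrow> nat \<Rightarrow> nat \<Rightarrow> complex \<Rightarrow> complex" where
  "scaled_ratio \<alpha> i m t = poly (cpoly (nlaguerre \<alpha> (m + i))) (of_nat m * t) / poly (cpoly (nlaguerre \<alpha> m)) (of_nat m * t)"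

lemma nlaguerre_scaled_nonzero:
  assumes "\<alpha> > -1" "m > 0" "Im t \<noteq> 0"
  shows "poly (cpoly (nlaguerre \<alpha> m)) (of_nat m * t) \<noteq> 0"
proof
  assume "poly (cpoly (nlaguerre \<alpha> m)) (of_nat m * t) = 0"
  then have "of_nat m * t \<in> \<real>" by (rule nlaguerre_real_rooted[OF assms(1)])
  then have "Im (of_nat m * t) = 0" by (simp add: complex_is_Real_iff)
  then show False using assms by simp
qed

lemma scaled_ratio_0:
  assumes "\<alpha> > -1" "m > 0" "Im t \<noteq> 0"
  shows "scaled_ratio \<alpha> 0 m t = 1"
  using nlaguerre_scaled_nonzero[OF assms] by (simp add: scaled_ratio_def)

lemma scaled_ratio_1:
  assumes "\<alpha> > -1" "m > 0" "Im t \<noteq> 0"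
  shows "scaled_ratio \<alpha> 1 m t =
     1 - of_real (real m / (real m + 1 + \<alpha>)) * t + of_real (real m / (real m + 1 + \<alpha>)) * (t * scaled_log_deriv \<alpha> m t)"
proof -
  define L where "L = poly (cpoly (nlaguerre \<alpha> m)) (of_nat m * t)"
  define L1 where "L1 = poly (cpoly (nlaguerre \<alpha> (Suc m))) (of_nat m * t)"
  define L' where "L' = poly (pderiv (cpoly (nlaguerre \<alpha> m))) (of_nat m * t)"
  define s where "s = complex_of_real (real m + 1 + \<alpha>)"
  have "L \<noteq> 0" unfolding L_def by (rule nlaguerre_scaled_nonzero[OF assms])
  have "real m + 1 + \<alpha> \<noteq> 0" using assms by simp
  then have "s \<noteq> 0" unfolding s_def of_real_eq_0_iff .
  have "s * L1 = s * L - of_nat m * t * L + of_nat m * t * L'"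
    using arg_cong[OF nlaguerre_raise[OF assms(1), of m], of "\<lambda>p. poly (cpoly p) (of_nat m * t)"]
    unfolding s_def L1_def L_def L'_def
    by (simp only: cpoly_smult cpoly_minus cpoly_add cpoly_pCons cpoly_pderiv poly_smult poly_diff poly_add poly_pCons of_real_0 add_0)
  then have "s * L1 / (s * L) = (s * L - of_nat m * t * L + of_nat m * t * L') / (s * L)" by (simp only:)
  then have "L1 / L = (s * L - of_nat m * t * L + of_nat m * t * L') / (s * L)"
    using \<open>s \<noteq> 0\<close> by simp
  also have "\<dots> = 1 - of_nat m / s * t + of_nat m / s * (t * (L' / L))"
    using \<open>L \<noteq> 0\<close> \<open>s \<noteq> 0\<close> by (simp add: field_simps)
  finally have "L1 / L = 1 - of_nat m / s * t + of_nat m / s * (t * (L' / L))" .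
  then show ?thesis
    by (simp add: scaled_ratio_def scaled_log_deriv_def L1_def L_def L'_def s_def)
qed

lemma scaled_ratio_rec:
  assumes "\<alpha> > -1" "m > 0" "Im t \<noteq> 0"
  shows "scaled_ratio \<alpha> (Suc (Suc i)) m t =
     (of_real ((2 * real (Suc (m + i)) + 1 + \<alpha>) / (real (Suc (m + i)) + 1 + \<alpha>)) -
      of_real (real m / (real (Suc (m + i)) + 1 + \<alpha>)) * t) * scaled_ratio \<alpha> (Suc i) m t -
     of_real (real (Suc (m + i)) / (real (Suc (m + i)) + 1 + \<alpha>)) * scaled_ratio \<alpha> i m t"
proof -
  define L where "L = (\<lambda>j. poly (cpoly (nlaguerre \<alpha> (m + j))) (of_nat m * t))"
  define s where "s = complex_of_real (real (Suc (m + i)) + 1 + \<alpha>)"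
  have "L 0 \<noteq> 0" using nlaguerre_scaled_nonzero[OF assms] by (simp add: L_def)
  have "real (Suc (m + i)) + 1 + \<alpha> \<noteq> 0" using assms by simp
  then have "s \<noteq> 0" unfolding s_def of_real_eq_0_iff .
  have "s * L (Suc (Suc i)) = of_real (2 * real (Suc (m + i)) + 1 + \<alpha>) * L (Suc i) - of_nat m * t * L (Suc i) -
      of_real (real (Suc (m + i))) * L i"
    using arg_cong[OF nlaguerre_recurrence[OF assms(1), of "m + i"], of "\<lambda>p. poly (cpoly p) (of_nat m * t)"]
    unfolding s_def L_def add_Suc_right
    by (simp only: cpoly_smult cpoly_minus cpoly_add cpoly_pCons poly_smult poly_diff poly_add poly_pCons of_real_0 add_0)
  moreover have "l2 / l0 = (a / s - mm / s * t) * (l1 / l0) - b / s * (l / l0)"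
    if "s * l2 = a * l1 - mm * t * l1 - b * l" "l0 \<noteq> 0" for a b mm l l0 l1 l2 :: complex
  proof -
    have "l2 / l0 = s * l2 / (s * l0)" using \<open>s \<noteq> 0\<close> by simp
    also have "\<dots> = (a / s - mm / s * t) * (l1 / l0) - b / s * (l / l0)"
      unfolding that(1) using that(2) \<open>s \<noteq> 0\<close> by (simp add: field_simps)
    finally show ?thesis .
  qed
  ultimately have "L (Suc (Suc i)) / L 0 = (of_real (2 * real (Suc (m + i)) + 1 + \<alpha>) / s - of_nat m / s * t) * (L (Suc i) / L 0) -
      of_real (real (Suc (m + i))) / s * (L i / L 0)"
    using \<open>L 0 \<noteq> 0\<close> by blast
  then show ?thesis
    unfolding scaled_ratio_def L_def s_def of_real_divide of_real_of_nat_eq add_0_right .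
qed

lemma uniform_limit_scalar:
  "(a \<longlongrightarrow> l) F \<Longrightarrow> uniform_limit S (\<lambda>n t. a n) (\<lambda>_. l) F"
  by (auto intro!: uniform_limitI dest: tendstoD)

lemma continuous_on_joukowski_branch:
  assumes "\<And>t. t \<in> S \<Longrightarrow> Im t \<noteq> 0"
  shows "continuous_on S joukowski_branch"
  unfolding joukowski_branch_def[abs_def]
  by (intro continuous_on_diff continuous_on_divide continuous_on_mult continuous_on_add
        continuous_on_const continuous_on_id continuous_on_csqrt_arg assms) auto

text \<open>For \<open>i = 1\<close> this is the limit of the logarithmic derivative.  For larger \<open>i\<close> the three-term recurrence at
  \<open>x = m t\<close> tends to \<open>\<psi>^(i + 2) = (2 - t) \<psi>^(i + 1) - \<psi>^i\<close>.\<close>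

lemma uniform_limit_scaled_ratio:
  assumes "\<alpha> > -1" "compact S" "\<And>t. t \<in> S \<Longrightarrow> Im t \<noteq> 0"
  shows "uniform_limit S (scaled_ratio \<alpha> i) (\<lambda>t. joukowski_branch t ^ i) sequentially"
proof -
  have t0: "t \<noteq> 0" if "t \<in> S" for t using assms(3)[OF that] by auto
  have bdd: "bounded (f ` S)" if "continuous_on S f" for f :: "complex \<Rightarrow> complex"
    using assms(2) that by (intro compact_imp_bounded compact_continuous_image)
  have bdd_id: "bounded ((\<lambda>t. t) ` S)" by (rule bdd) (rule continuous_on_id)
  have bdd_const: "bounded ((\<lambda>t. c) ` S)" for c :: complex by (rule bdd) (rule continuous_on_const)
  have bdd_pow: "bounded ((\<lambda>t. joukowski_branch t ^ i) ` S)" for i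
    by (intro bdd continuous_on_power continuous_on_joukowski_branch assms(3))
  have bdd_tg: "bounded ((\<lambda>t. t * log_deriv_limit t) ` S)"
    unfolding log_deriv_limit_def
    by (intro bdd continuous_on_diff continuous_on_divide continuous_on_mult
        continuous_on_const continuous_on_id continuous_on_csqrt_arg assms(3)) auto
  have bdd_g: "bounded (log_deriv_limit ` S)"
    unfolding log_deriv_limit_def[abs_def]
    by (intro bdd continuous_on_diff continuous_on_divide
        continuous_on_const continuous_on_id continuous_on_csqrt_arg assms(3)) auto
  have bdd_2t: "bounded ((\<lambda>t. 2 - 1 * t) ` S)"
    by (intro bdd continuous_on_diff continuous_on_mult continuous_on_const continuous_on_id)
  show ?thesis
  proof (induction i rule: induct_nat_012)
    case 0
    have "uniform_limit S (scaled_ratio \<alpha> 0) (\<lambda>t. joukowski_branch t ^ 0) sequentially \<longleftrightarrow>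
        uniform_limit S (\<lambda>m t. 1 :: complex) (\<lambda>t. 1) sequentially"
    proof (rule uniform_limit_cong)
      show "\<forall>\<^sub>F m in sequentially. \<forall>t\<in>S. scaled_ratio \<alpha> 0 m t = 1"
        using eventually_gt_at_top[of 0] by eventually_elim (use scaled_ratio_0 assms in auto)
    qed simp
    then show ?case by (simp add: uniform_limit_const)
  next
    case 1
    define r where "r = (\<lambda>m. complex_of_real (real m / (real m + 1 + \<alpha>)))"
    have "(\<lambda>m. real m / (real m + 1 + \<alpha>)) \<longlonglongrightarrow> 1" by real_asymp
    from tendsto_of_real[OF this, where 'a = complex] have "r \<longlonglongrightarrow> 1"
      by (simp only: r_def of_real_1 of_real_numeral)
    then have r: "uniform_limit S (\<lambda>m t. r m) (\<lambda>_. 1) sequentially"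
      by (rule uniform_limit_scalar)
    have "uniform_limit S (\<lambda>m t. 1 - r m * t + r m * (t * scaled_log_deriv \<alpha> m t))
        (\<lambda>t. 1 - 1 * t + 1 * (t * log_deriv_limit t)) sequentially"
      by (intro uniform_limit_add uniform_limit_minus uniform_lim_mult uniform_limit_const r bdd_id bdd_const
          bdd_g bdd_tg uniform_limit_scaled_log_deriv assms)
    moreover have "uniform_limit S (scaled_ratio \<alpha> (Suc 0)) (\<lambda>t. joukowski_branch t ^ Suc 0) sequentially \<longleftrightarrow>
        uniform_limit S (\<lambda>m t. 1 - r m * t + r m * (t * scaled_log_deriv \<alpha> m t))
        (\<lambda>t. 1 - 1 * t + 1 * (t * log_deriv_limit t)) sequentially"
    proof (rule uniform_limit_cong)
      show "\<forall>\<^sub>F m in sequentially. \<forall>t\<in>S. scaled_ratio \<alpha> (Suc 0) m t = 1 - r m * t + r m * (t * scaled_log_deriv \<alpha> m t)"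
        using eventually_gt_at_top[of 0]
        by eventually_elim (use scaled_ratio_1 assms in \<open>auto simp: r_def\<close>)
      show "joukowski_branch t ^ Suc 0 = 1 - 1 * t + 1 * (t * log_deriv_limit t)" for t
        by (simp add: joukowski_branch_def log_deriv_limit_def field_simps)
    qed
    ultimately show ?case by simp
  next
    case (ge2 i)
    define a where "a = (\<lambda>m. complex_of_real ((2 * real (Suc (m + i)) + 1 + \<alpha>) / (real (Suc (m + i)) + 1 + \<alpha>)))"
    define b where "b = (\<lambda>m. complex_of_real (real m / (real (Suc (m + i)) + 1 + \<alpha>)))"
    define c where "c = (\<lambda>m. complex_of_real (real (Suc (m + i)) / (real (Suc (m + i)) + 1 + \<alpha>)))"
    have lim1: "(\<lambda>m. (real m + B) / (real m + C)) \<longlonglongrightarrow> 1" for B C by real_asymp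
    have lim2: "(\<lambda>m. (2 * real m + B) / (real m + C)) \<longlonglongrightarrow> 2" for B C by real_asymp
    have "(\<lambda>m. (2 * real (Suc (m + i)) + 1 + \<alpha>) / (real (Suc (m + i)) + 1 + \<alpha>)) \<longlonglongrightarrow> 2"
      using lim2[of "2 * real i + 3 + \<alpha>" "real i + 2 + \<alpha>"] by (simp add: distrib_left add_ac)
    from tendsto_of_real[OF this, where 'a = complex] have "a \<longlonglongrightarrow> 2"
      by (simp only: a_def of_real_1 of_real_numeral)
    then have a: "uniform_limit S (\<lambda>m t. a m) (\<lambda>_. 2) sequentially"
      by (rule uniform_limit_scalar)
    have "(\<lambda>m. real m / (real (Suc (m + i)) + 1 + \<alpha>)) \<longlonglongrightarrow> 1"
      using lim1[of 0 "real i + 2 + \<alpha>"] by (simp add: add_ac)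
    from tendsto_of_real[OF this, where 'a = complex] have "b \<longlonglongrightarrow> 1"
      by (simp only: b_def of_real_1 of_real_numeral)
    then have b: "uniform_limit S (\<lambda>m t. b m) (\<lambda>_. 1) sequentially"
      by (rule uniform_limit_scalar)
    have "(\<lambda>m. real (Suc (m + i)) / (real (Suc (m + i)) + 1 + \<alpha>)) \<longlonglongrightarrow> 1"
      using lim1[of "real i + 1" "real i + 2 + \<alpha>"] by (simp add: add_ac)
    from tendsto_of_real[OF this, where 'a = complex] have "c \<longlonglongrightarrow> 1"
      by (simp only: c_def of_real_1 of_real_numeral)
    then have c: "uniform_limit S (\<lambda>m t. c m) (\<lambda>_. 1) sequentially"
      by (rule uniform_limit_scalar)
    have "uniform_limit S (\<lambda>m t. (a m - b m * t) * scaled_ratio \<alpha> (Suc i) m t - c m * scaled_ratio \<alpha> i m t)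
        (\<lambda>t. (2 - 1 * t) * joukowski_branch t ^ Suc i - 1 * joukowski_branch t ^ i) sequentially"
      by (intro uniform_limit_minus uniform_lim_mult uniform_limit_const a b c ge2 bdd_id bdd_const bdd_pow bdd_2t)
    moreover have "uniform_limit S (scaled_ratio \<alpha> (Suc (Suc i))) (\<lambda>t. joukowski_branch t ^ Suc (Suc i)) sequentially \<longleftrightarrow>
        uniform_limit S (\<lambda>m t. (a m - b m * t) * scaled_ratio \<alpha> (Suc i) m t - c m * scaled_ratio \<alpha> i m t)
        (\<lambda>t. (2 - 1 * t) * joukowski_branch t ^ Suc i - 1 * joukowski_branch t ^ i) sequentially"
    proof (rule uniform_limit_cong)
      show "\<forall>\<^sub>F m in sequentially. \<forall>t\<in>S. scaled_ratio \<alpha> (Suc (Suc i)) m t =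
          (a m - b m * t) * scaled_ratio \<alpha> (Suc i) m t - c m * scaled_ratio \<alpha> i m t"
        using eventually_gt_at_top[of 0]
      proof eventually_elim
        case (elim m)
        show ?case
          unfolding a_def b_def c_def using scaled_ratio_rec[OF assms(1) elim] assms(3) by blast
      qed
      show "joukowski_branch t ^ Suc (Suc i) = (2 - 1 * t) * joukowski_branch t ^ Suc i - 1 * joukowski_branch t ^ i" if "t \<in> S" for t
      proof -
        have "joukowski_branch t ^ Suc (Suc i) = (joukowski_branch t * joukowski_branch t) * joukowski_branch t ^ i" by (simp add: mult_ac)
        also have "\<dots> = ((2 - t) * joukowski_branch t - 1) * joukowski_branch t ^ i"
          unfolding joukowski_branch_quadratic[OF t0[OF that]] ..
        finally show ?thesis by (simp add: algebra_simps)
      qed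
    qed
    ultimately show ?case by simp
  qed
qed

lemma uniform_limit_sum_finite:
  fixes f :: "'i \<Rightarrow> 'n \<Rightarrow> 'b \<Rightarrow> 'c::real_normed_vector"
  assumes "\<And>i. i \<in> I \<Longrightarrow> uniform_limit S (f i) (l i) F"
  shows "uniform_limit S (\<lambda>n t. \<Sum>i\<in>I. f i n t) (\<lambda>t. \<Sum>i\<in>I. l i t) F"
  using assms
proof (induction I rule: infinite_finite_induct)
  case (insert i I)
  then have "uniform_limit S (\<lambda>n t. f i n t + (\<Sum>i\<in>I. f i n t)) (\<lambda>t. l i t + (\<Sum>i\<in>I. l i t)) F"
    by (intro uniform_limit_add) auto
  then show ?case using insert.hyps by simp
qed (simp_all add: uniform_limit_const)

text \<open>The polynomial \<open>q\<^sub>n\<close> with characteristic polynomial \<open>R\<close> of degree \<open>d\<close> and \<open>n = d + m\<close>; the index \<open>m\<close>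
  removes the truncated subtraction.\<close>

definition shifted_family :: "real \<Rightarrow> real poly \<Rightarrow> nat \<Rightarrow> real poly" where
  "shifted_family \<alpha> R m = lag_transform \<alpha> ([:1, 1:] ^ m * pcompose R [:1, 1:])"

lemma uniform_limit_shifted_family:
  assumes "\<alpha> > -1" "compact S" "\<And>t. t \<in> S \<Longrightarrow> Im t \<noteq> 0"
  shows "uniform_limit S
    (\<lambda>m t. poly (cpoly (shifted_family \<alpha> R m)) (of_nat m * t) / poly (cpoly (nlaguerre \<alpha> m)) (of_nat m * t))
    (\<lambda>t. poly (cpoly R) (joukowski_branch t)) sequentially"
proof -
  have eq: "poly (cpoly (shifted_family \<alpha> R m)) (of_nat m * t) / poly (cpoly (nlaguerre \<alpha> m)) (of_nat m * t)
      = (\<Sum>i\<le>degree R. complex_of_real (coeff R i) * scaled_ratio \<alpha> i m t)" for m t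
    unfolding shifted_family_def lag_transform_pcompose[OF assms(1)]
    by (simp add: cpoly_sum cpoly_smult poly_sum scaled_ratio_def sum_divide_distrib)
  have lim: "poly (cpoly R) (joukowski_branch t) = (\<Sum>i\<le>degree R. complex_of_real (coeff R i) * joukowski_branch t ^ i)" for t
    unfolding poly_altdef degree_cpoly by (simp add: coeff_map_poly)
  have "bounded ((\<lambda>t. joukowski_branch t ^ i) ` S)" for i
    using assms(2) by (intro compact_imp_bounded compact_continuous_image continuous_on_power continuous_on_joukowski_branch assms(3))
  moreover have "bounded ((\<lambda>t. complex_of_real x) ` S)" for x
    using assms(2) by (intro compact_imp_bounded compact_continuous_image continuous_on_const)
  ultimately show ?thesis
    unfolding eq lim using assms
    by (intro uniform_limit_sum_finite uniform_lim_mult uniform_limit_const uniform_limit_scaled_ratio) auto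
qed

section \<open>Non-real zeros by Rouche's theorem\<close>

lemma Im_joukowski_nonzero:
  assumes "\<zeta> \<notin> \<real>" "cmod \<zeta> > 1"
  shows "Im (2 - \<zeta> - 1 / \<zeta>) \<noteq> 0"
proof -
  have "Im \<zeta> \<noteq> 0" using assms(1) by (simp add: complex_is_Real_iff)
  have "(cmod \<zeta>)\<^sup>2 > 1" using assms(2) by (simp add: one_less_power)
  have "Im (2 - \<zeta> - 1 / \<zeta>) = Im \<zeta> * (1 / (cmod \<zeta>)\<^sup>2 - 1)"
    by (simp add: Im_divide cmod_power2 algebra_simps)
  moreover have "1 / (cmod \<zeta>)\<^sup>2 - 1 \<noteq> 0" using \<open>(cmod \<zeta>)\<^sup>2 > 1\<close> by auto
  ultimately show ?thesis using \<open>Im \<zeta> \<noteq> 0\<close> by simp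
qed

lemma holomorphic_joukowski_branch:
  assumes "\<And>t. t \<in> S \<Longrightarrow> Im t \<noteq> 0"
  shows "joukowski_branch holomorphic_on S"
proof -
  have arg: "1 - 4 / t \<notin> \<real>\<^sub>\<le>\<^sub>0" if "t \<in> S" for t
    using assms[OF that] by (rule csqrt_arg_off_cut)
  have nz: "t \<noteq> 0" if "t \<in> S" for t using assms[OF that] by auto
  have "(\<lambda>t. 1 - 4 / t) holomorphic_on S"
    by (intro holomorphic_on_diff holomorphic_on_divide holomorphic_on_const holomorphic_on_ident) (rule nz)
  then have "(\<lambda>t. csqrt (1 - 4 / t)) holomorphic_on S"
    using arg by (rule holomorphic_on_csqrt')
  then show ?thesis
    unfolding joukowski_branch_def[abs_def]
    by (intro holomorphic_on_diff holomorphic_on_divide holomorphic_on_mult holomorphic_on_add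
        holomorphic_on_const holomorphic_on_ident) auto
qed

lemma holomorphic_poly_compose:
  "f holomorphic_on S \<Longrightarrow> (\<lambda>t. poly p (f t)) holomorphic_on S"
  by (induction p) (auto intro!: holomorphic_intros)

lemma zorder_poly_scaled:
  fixes Q L :: "complex poly"
  assumes "open S" "p \<in> S" "Q \<noteq> 0" "a \<noteq> 0" "\<And>w. w \<in> S \<Longrightarrow> poly L (a * w) \<noteq> 0"
  shows "zorder (\<lambda>t. poly Q (a * t) / poly L (a * t)) p = int (order (a * p) Q)"
proof -
  let ?k = "order (a * p) Q"
  obtain q where q: "Q = [:- (a * p), 1:] ^ ?k * q" "\<not> [:- (a * p), 1:] dvd q"
    using order_decomp[OF assms(3)] by blast
  have q0: "poly q (a * p) \<noteq> 0" using q(2) by (simp add: poly_eq_0_iff_dvd)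
  have Q: "poly Q z = (z - a * p) ^ ?k * poly q z" for z
    by (subst q(1)) (simp add: poly_power)
  show ?thesis
  proof (rule zorder_eqI[OF assms(1,2)])
    show "(\<lambda>w. a ^ ?k * poly q (a * w) / poly L (a * w)) holomorphic_on S"
      using assms(5) by (intro holomorphic_intros holomorphic_poly_compose) auto
    show "a ^ ?k * poly q (a * p) / poly L (a * p) \<noteq> 0" using q0 assms by auto
    fix w assume "w \<in> S" "w \<noteq> p"
    have "a * w - a * p = a * (w - p)" by (simp add: algebra_simps)
    then show "poly Q (a * w) / poly L (a * w) = a ^ ?k * poly q (a * w) / poly L (a * w) * (w - p) powi int ?k"
      unfolding Q by (simp add: power_mult_distrib)
  qed
qed

text \<open>The branch \<open>\<psi>\<close> is a local coordinate at \<open>t\<^sub>0 = 2 - \<zeta> - 1 / \<zeta>\<close>, so multiplicities are preserved.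
  Explicitly \<open>t - t\<^sub>0 = - (\<psi> - \<zeta>) (1 - 1 / (\<psi> \<zeta>))\<close>.  The second factor does not vanish: \<open>\<psi>(t) = 1 / \<zeta>\<close> would
  give \<open>t = t\<^sub>0\<close>, hence \<open>\<psi>(t) = \<zeta>\<close> and \<open>\<zeta>\<^sup>2 = 1\<close>.\<close>

lemma zorder_poly_joukowski_branch:
  fixes Q :: "complex poly"
  assumes "open S" "\<And>t. t \<in> S \<Longrightarrow> Im t \<noteq> 0" "Q \<noteq> 0" "\<zeta> \<notin> \<real>" "cmod \<zeta> > 1" "2 - \<zeta> - 1 / \<zeta> \<in> S"
  shows "zorder (\<lambda>t. poly Q (joukowski_branch t)) (2 - \<zeta> - 1 / \<zeta>) = int (order \<zeta> Q)"
proof -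
  define t0 where "t0 = 2 - \<zeta> - 1 / \<zeta>"
  let ?k = "order \<zeta> Q"
  let ?\<psi> = joukowski_branch
  have \<psi>0: "?\<psi> t0 = \<zeta>" unfolding t0_def by (rule joukowski_branch_at) fact
  have "\<zeta> \<noteq> 0" using assms(5) by auto
  obtain q where q: "Q = [:- \<zeta>, 1:] ^ ?k * q" "\<not> [:- \<zeta>, 1:] dvd q"
    using order_decomp[OF assms(3)] by blast
  have q0: "poly q \<zeta> \<noteq> 0" using q(2) by (simp add: poly_eq_0_iff_dvd)
  have Q: "poly Q z = (z - \<zeta>) ^ ?k * poly q z" for z
    by (subst q(1)) (simp add: poly_power)
  have dist: "t - t0 = - (?\<psi> t - \<zeta>) * ((?\<psi> t * \<zeta> - 1) / (?\<psi> t * \<zeta>))" and \<psi>nz: "?\<psi> t \<noteq> 0" if "t \<in> S" for t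
  proof -
    have "t \<noteq> 0" using assms(2)[OF that] by auto
    then have \<psi>: "?\<psi> t \<noteq> 0" "t = 2 - ?\<psi> t - 1 / ?\<psi> t" using joukowski_branch_inverse by blast+
    have "(2 - x - 1 / x) - (2 - \<zeta> - 1 / \<zeta>) = - (x - \<zeta>) * ((x * \<zeta> - 1) / (x * \<zeta>))" if "x \<noteq> 0" for x
      using that \<open>\<zeta> \<noteq> 0\<close> by (simp add: field_simps)
    from this[OF \<psi>(1)] show "t - t0 = - (?\<psi> t - \<zeta>) * ((?\<psi> t * \<zeta> - 1) / (?\<psi> t * \<zeta>))"
      unfolding t0_def \<psi>(2)[symmetric] .
    show "?\<psi> t \<noteq> 0" by fact
  qed
  have ne1: "?\<psi> t * \<zeta> - 1 \<noteq> 0" if "t \<in> S" for t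
  proof
    assume 0: "?\<psi> t * \<zeta> - 1 = 0"
    then have "t = t0" using dist[OF that] by simp
    then have "\<zeta> * \<zeta> = 1" using 0 \<psi>0 by simp
    then have "cmod \<zeta> * cmod \<zeta> = 1" by (metis norm_mult norm_one)
    moreover have "1 < cmod \<zeta> * cmod \<zeta>" using assms(5) by (rule less_1_mult) (rule assms(5))
    ultimately show False by simp
  qed
  define v where "v = (\<lambda>t. - (?\<psi> t * \<zeta>) / (?\<psi> t * \<zeta> - 1))"
  have "t0 \<in> S" using assms(6) by (simp add: t0_def)
  have hol: "?\<psi> holomorphic_on S" by (rule holomorphic_joukowski_branch) fact
  show ?thesis
    unfolding t0_def[symmetric]
  proof (rule zorder_eqI[OF assms(1) \<open>t0 \<in> S\<close>])
    show "(\<lambda>t. v t ^ ?k * poly q (?\<psi> t)) holomorphic_on S"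
      unfolding v_def using ne1 by (intro holomorphic_intros holomorphic_poly_compose hol) auto
    show "v t0 ^ ?k * poly q (?\<psi> t0) \<noteq> 0"
      using ne1[OF \<open>t0 \<in> S\<close>] q0 \<open>\<zeta> \<noteq> 0\<close> by (simp add: v_def \<psi>0)
    fix t assume t: "t \<in> S" "t \<noteq> t0"
    have "?\<psi> t - \<zeta> = v t * (t - t0)"
      unfolding dist[OF t(1)] v_def using ne1[OF t(1)] \<psi>nz[OF t(1)] \<open>\<zeta> \<noteq> 0\<close> by (simp add: divide_simps)
    then show "poly Q (?\<psi> t) = v t ^ ?k * poly q (?\<psi> t) * (t - t0) powi int ?k"
      unfolding Q by (simp add: power_mult_distrib)
  qed
qed

lemma shifted_family_nonzero:
  assumes "\<alpha> > -1" "R \<noteq> 0"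
  shows "shifted_family \<alpha> R m \<noteq> 0"
  using assms by (simp add: shifted_family_def lag_transform_eq_0_iff pcompose_eq_0_iff)

text \<open>Rouche's theorem on a small circle around \<open>t\<^sub>0\<close> that encloses no other zero of \<open>R(\<psi>(t))\<close>, with
  the quotient \<open>q\<^sub>n(m t) / L\<^sub>m(m t)\<close> as perturbation.\<close>

lemma zeros_near_joukowski_image:
  fixes R :: "real poly"
  assumes "\<alpha> > -1" "R \<noteq> 0" "poly (cpoly R) \<zeta> = 0" "\<zeta> \<notin> \<real>" "cmod \<zeta> > 1" "e > 0"
  defines "t0 \<equiv> 2 - \<zeta> - 1 / \<zeta>"
  shows "\<exists>\<rho>>0. \<rho> \<le> e \<and> (\<forall>\<^sub>F m in sequentially.
    (\<Sum>t\<in>{t \<in> ball t0 \<rho>. poly (cpoly (shifted_family \<alpha> R m)) (of_nat m * t) = 0}.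
       order (of_nat m * t) (cpoly (shifted_family \<alpha> R m))) = order \<zeta> (cpoly R))"
proof -
  define T where "T = (\<lambda>w. 2 - w - 1 / w) ` {w. poly (cpoly R) w = 0}"
  have "finite T" unfolding T_def using assms(2) by (intro finite_imageI poly_roots_finite) simp
  then obtain d where d: "d > 0" "\<And>x. x \<in> T \<Longrightarrow> x \<noteq> t0 \<Longrightarrow> d \<le> dist t0 x"
    using finite_set_avoid[of T t0] by blast
  have Im0: "Im t0 \<noteq> 0" unfolding t0_def by (rule Im_joukowski_nonzero) fact+
  \<comment> \<open>The disc of radius r avoids the real line and the images of all other zeros of R.\<close>
  define r where "r = min (min e d) \<bar>Im t0\<bar>"
  define \<rho> where "\<rho> = r / 2"
  have r: "r > 0" "r \<le> e" "r \<le> d" "r \<le> \<bar>Im t0\<bar>" using assms(6) d(1) Im0 by (auto simp: r_def)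
  have \<rho>: "\<rho> > 0" "\<rho> < r" "\<rho> \<le> e" using r by (auto simp: \<rho>_def)
  define S where "S = ball t0 r"
  have sub: "cball t0 \<rho> \<subseteq> S" using \<rho> by (auto simp: S_def)
  have ImS: "Im t \<noteq> 0" if "t \<in> S" for t
  proof
    assume "Im t = 0"
    then have "\<bar>Im t0\<bar> \<le> cmod (t0 - t)" using abs_Im_le_cmod[of "t0 - t"] by simp
    then show False using that r by (simp add: S_def dist_norm)
  qed
  define H where "H = (\<lambda>t. poly (cpoly R) (joukowski_branch t))"
  define h where "h = (\<lambda>m t. poly (cpoly (shifted_family \<alpha> R m)) (of_nat m * t) / poly (cpoly (nlaguerre \<alpha> m)) (of_nat m * t))"
  have H_hol: "H holomorphic_on S"
    unfolding H_def by (intro holomorphic_poly_compose holomorphic_joukowski_branch ImS)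
  have H_zero: "{p \<in> S. H p = 0} = {t0}"
  proof (intro equalityI subsetI)
    fix t assume t: "t \<in> {p \<in> S. H p = 0}"
    then have "t \<noteq> 0" using ImS by force
    then have "t \<in> T" using joukowski_branch_inverse(2)[of t] t unfolding T_def H_def by blast
    then show "t \<in> {t0}" using d(2)[of t] t r by (force simp: S_def)
  next
    fix t assume "t \<in> {t0}"
    then show "t \<in> {p \<in> S. H p = 0}"
      using assms(3) joukowski_branch_at[OF assms(5)] r by (simp add: H_def t0_def S_def)
  qed
  obtain \<delta> where \<delta>: "\<delta> > 0" "\<And>t. t \<in> sphere t0 \<rho> \<Longrightarrow> \<delta> \<le> cmod (H t)"
  proof -
    have sp: "sphere t0 \<rho> \<subseteq> S" using sub by auto
    have "continuous_on (sphere t0 \<rho>) (\<lambda>t. cmod (H t))"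
      by (intro continuous_on_norm holomorphic_on_imp_continuous_on holomorphic_on_subset[OF H_hol sp])
    moreover have "sphere t0 \<rho> \<noteq> {}" using \<rho> by simp
    ultimately obtain x where x: "x \<in> sphere t0 \<rho>" "\<And>t. t \<in> sphere t0 \<rho> \<Longrightarrow> cmod (H x) \<le> cmod (H t)"
      using continuous_attains_inf[of "sphere t0 \<rho>" "\<lambda>t. cmod (H t)"] by auto
    have "x \<noteq> t0" using x(1) \<rho> by auto
    then have "H x \<noteq> 0" using H_zero x(1) sp by blast
    then show ?thesis using x(2) by (intro that[of "cmod (H x)"]) auto
  qed
  have "uniform_limit (cball t0 \<rho>) h H sequentially"
    unfolding h_def H_def using sub ImS by (intro uniform_limit_shifted_family[OF assms(1)]) auto
  then have "\<forall>\<^sub>F m in sequentially. \<forall>t\<in>cball t0 \<rho>. dist (h m t) (H t) < \<delta>"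
    using \<delta>(1) by (rule uniform_limitD)
  then have "\<forall>\<^sub>F m in sequentially.
    (\<Sum>t\<in>{t \<in> ball t0 \<rho>. poly (cpoly (shifted_family \<alpha> R m)) (of_nat m * t) = 0}.
       order (of_nat m * t) (cpoly (shifted_family \<alpha> R m))) = order \<zeta> (cpoly R)"
    using eventually_gt_at_top[of 0]
  proof eventually_elim
    case (elim m)
    define Q where "Q = cpoly (shifted_family \<alpha> R m)"
    have "Q \<noteq> 0" using shifted_family_nonzero[OF assms(1,2)] by (simp add: Q_def)
    have L_nz: "poly (cpoly (nlaguerre \<alpha> m)) (of_nat m * t) \<noteq> 0" if "t \<in> S" for t
      by (rule nlaguerre_scaled_nonzero[OF assms(1) elim(2) ImS[OF that]])
    have h_eq: "h m = (\<lambda>t. poly Q (of_nat m * t) / poly (cpoly (nlaguerre \<alpha> m)) (of_nat m * t))"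
      by (simp add: h_def Q_def)
    have h_hol: "h m holomorphic_on S"
      unfolding h_eq using L_nz by (intro holomorphic_intros holomorphic_poly_compose) auto
    have h_zero: "h m t = 0 \<longleftrightarrow> poly Q (of_nat m * t) = 0" if "t \<in> S" for t
      using L_nz[OF that] by (simp add: h_eq)
    have "finite ((\<lambda>t. of_nat m * t) -` {z. poly Q z = 0})"
      using \<open>Q \<noteq> 0\<close> elim(2) by (intro finite_vimageI poly_roots_finite) (auto simp: inj_on_def)
    then have finZ: "finite {p \<in> S. h m p = 0}"
      by (rule finite_subset[rotated]) (use h_zero in auto)
    have close: "cmod (h m t - H t) < cmod (H t)" if "t \<in> sphere t0 \<rho>" for t
    proof -
      have "t \<in> cball t0 \<rho>" using that by auto
      with elim(1) have "cmod (h m t - H t) < \<delta>" by (simp add: dist_norm)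
      then show ?thesis using \<delta>(2)[OF that] by simp
    qed
    have split: "(\<lambda>p. H p + (h m p - H p)) = h m" by simp
    let ?\<gamma> = "circlepath t0 \<rho>"
    have img: "path_image ?\<gamma> = sphere t0 \<rho>" using \<rho> by simp
    have outside: "winding_number ?\<gamma> z = 0" if "z \<notin> cball t0 \<rho>" for z
      by (rule winding_number_zero_outside[of _ "cball t0 \<rho>"]) (use that img in auto)
    have rouche: "(\<Sum>p\<in>{p \<in> S. h m p = 0}. winding_number ?\<gamma> p * zorder (h m) p) =
        (\<Sum>p\<in>{p \<in> S. H p = 0}. winding_number ?\<gamma> p * zorder H p)"
    proof -
      have "finite {p \<in> S. H p + (h m p - H p) = 0}" using finZ by simp
      moreover have "(\<lambda>p. h m p - H p) holomorphic_on S" by (intro holomorphic_on_diff h_hol H_hol)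
      moreover have "\<forall>z\<in>path_image ?\<gamma>. cmod (H z) > cmod (h m z - H z)" using close img by auto
      moreover have "\<forall>z. z \<notin> S \<longrightarrow> winding_number ?\<gamma> z = 0" using outside sub by blast
      ultimately have "(\<Sum>p\<in>{p \<in> S. H p + (h m p - H p) = 0}. winding_number ?\<gamma> p * zorder (\<lambda>p. H p + (h m p - H p)) p) =
        (\<Sum>p\<in>{p \<in> S. H p = 0}. winding_number ?\<gamma> p * zorder H p)"
        using H_zero img sub H_hol by (intro Rouche_theorem) (auto simp: S_def)
      then show ?thesis unfolding split by simp
    qed
    have rhs: "(\<Sum>p\<in>{p \<in> S. H p = 0}. winding_number ?\<gamma> p * zorder H p) = of_nat (order \<zeta> (cpoly R))"
    proof -
      have "t0 \<in> S" using r by (simp add: S_def)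
      then have "zorder H t0 = int (order \<zeta> (cpoly R))"
        unfolding H_def t0_def using assms ImS by (intro zorder_poly_joukowski_branch[of S]) (auto simp: S_def)
      then show ?thesis unfolding H_zero using \<rho> by (simp add: winding_number_circlepath)
    qed
    have zset: "{t \<in> ball t0 \<rho>. poly Q (of_nat m * t) = 0} \<subseteq> {p \<in> S. h m p = 0}"
      using h_zero \<rho> by (auto simp: S_def)
    have lhs: "(\<Sum>p\<in>{p \<in> S. h m p = 0}. winding_number ?\<gamma> p * zorder (h m) p) =
        (\<Sum>t\<in>{t \<in> ball t0 \<rho>. poly Q (of_nat m * t) = 0}. of_nat (order (of_nat m * t) Q))"
    proof (rule sum.mono_neutral_cong_right[OF finZ zset])
      show "\<forall>p\<in>{p \<in> S. h m p = 0} - {t \<in> ball t0 \<rho>. poly Q (of_nat m * t) = 0}.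
          winding_number ?\<gamma> p * zorder (h m) p = 0"
      proof
        fix p assume p: "p \<in> {p \<in> S. h m p = 0} - {t \<in> ball t0 \<rho>. poly Q (of_nat m * t) = 0}"
        then have "p \<notin> ball t0 \<rho>" using h_zero by auto
        moreover have "p \<notin> sphere t0 \<rho>" using close[of p] p by auto
        ultimately have "p \<notin> cball t0 \<rho>" by auto
        then show "winding_number ?\<gamma> p * zorder (h m) p = 0" using outside by simp
      qed
      fix t assume t: "t \<in> {t \<in> ball t0 \<rho>. poly Q (of_nat m * t) = 0}"
      then have "t \<in> S" using zset by blast
      have "winding_number ?\<gamma> t = 1"
        using t by (intro winding_number_circlepath) (simp add: dist_norm norm_minus_commute)
      moreover have "zorder (h m) t = int (order (of_nat m * t) Q)"
        unfolding h_eq by (rule zorder_poly_scaled[of S]) (use \<open>t \<in> S\<close> \<open>Q \<noteq> 0\<close> elim(2) L_nz in \<open>auto simp: S_def\<close>)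
      ultimately show "winding_number ?\<gamma> t * zorder (h m) t = of_nat (order (of_nat m * t) Q)" by simp
    qed
    have "complex_of_nat (\<Sum>t\<in>{t \<in> ball t0 \<rho>. poly Q (of_nat m * t) = 0}. order (of_nat m * t) Q) =
        of_nat (order \<zeta> (cpoly R))"
      using rouche unfolding lhs rhs by simp
    then show ?case unfolding Q_def of_nat_eq_iff .
  qed
  then show ?thesis using \<rho> by blast
qed

text \<open>Distinct non-real zeros \<open>\<zeta>\<close> of \<open>R\<close> have distinct images \<open>2 - \<zeta> - 1 / \<zeta>\<close>, because all of them lie outside
  the unit disc.  Disjoint discs around the images, away from the real line, hold enough zeros.\<close>

lemma eventually_num_nonreal_zeros_ge:
  assumes "\<alpha> > -1" "R \<noteq> 0"
    and "\<And>z. z \<notin> \<real> \<Longrightarrow> cmod z \<le> 1 \<Longrightarrow> poly (cpoly R) z \<noteq> 0"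
  shows "\<forall>\<^sub>F m in sequentially. num_nonreal_zeros R \<le> num_nonreal_zeros (shifted_family \<alpha> R m)"
proof -
  define \<Xi> where "\<Xi> = {z. z \<notin> \<real> \<and> poly (cpoly R) z = 0}"
  define \<tau> where "\<tau> = (\<lambda>z::complex. 2 - z - 1 / z)"
  have fin: "finite \<Xi>" unfolding \<Xi>_def using assms(2)
    by (intro finite_subset[OF _ poly_roots_finite[of "cpoly R"]]) auto
  have big: "cmod \<zeta> > 1" if "\<zeta> \<in> \<Xi>" for \<zeta> using assms(3)[of \<zeta>] that by (cases "cmod \<zeta> \<le> 1") (auto simp: \<Xi>_def)
  have inj: "\<tau> \<zeta> \<noteq> \<tau> \<zeta>'" if "\<zeta> \<in> \<Xi>" "\<zeta>' \<in> \<Xi>" "\<zeta> \<noteq> \<zeta>'" for \<zeta> \<zeta>'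
    using joukowski_branch_at[OF big[OF that(1)]] joukowski_branch_at[OF big[OF that(2)]] that(3)
    unfolding \<tau>_def by metis
  define zsum where "zsum = (\<lambda>\<zeta> \<rho> m. \<Sum>t\<in>{t \<in> ball (\<tau> \<zeta>) \<rho>. poly (cpoly (shifted_family \<alpha> R m)) (of_nat m * t) = 0}.
       order (of_nat m * t) (cpoly (shifted_family \<alpha> R m)))"
  define good where "good = (\<lambda>\<zeta> \<rho>. \<rho> > 0 \<and> (\<forall>x\<in>\<tau> ` \<Xi>. x \<noteq> \<tau> \<zeta> \<longrightarrow> 2 * \<rho> \<le> dist (\<tau> \<zeta>) x) \<and>
     \<rho> \<le> \<bar>Im (\<tau> \<zeta>)\<bar> \<and> (\<forall>\<^sub>F m in sequentially. zsum \<zeta> \<rho> m = order \<zeta> (cpoly R)))"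
  have "\<exists>\<rho>. good \<zeta> \<rho>" if \<zeta>: "\<zeta> \<in> \<Xi>" for \<zeta>
  proof -
    obtain d where d: "d > 0" "\<And>x. x \<in> \<tau> ` \<Xi> \<Longrightarrow> x \<noteq> \<tau> \<zeta> \<Longrightarrow> d \<le> dist (\<tau> \<zeta>) x"
      using finite_set_avoid[of "\<tau> ` \<Xi>" "\<tau> \<zeta>"] fin by blast
    have "Im (\<tau> \<zeta>) \<noteq> 0" unfolding \<tau>_def using \<zeta> big[OF \<zeta>] by (intro Im_joukowski_nonzero) (auto simp: \<Xi>_def)
    then have "min (d / 2) \<bar>Im (\<tau> \<zeta>)\<bar> > 0" using d(1) by simp
    then obtain \<rho> where \<rho>: "\<rho> > 0" "\<rho> \<le> min (d / 2) \<bar>Im (\<tau> \<zeta>)\<bar>"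
        "\<forall>\<^sub>F m in sequentially. zsum \<zeta> \<rho> m = order \<zeta> (cpoly R)"
      using zeros_near_joukowski_image[OF assms(1,2) _ _ big[OF \<zeta>], of "min (d / 2) \<bar>Im (\<tau> \<zeta>)\<bar>"] \<zeta>
      unfolding zsum_def \<tau>_def \<Xi>_def by blast
    have "2 * \<rho> \<le> dist (\<tau> \<zeta>) x" if "x \<in> \<tau> ` \<Xi>" "x \<noteq> \<tau> \<zeta>" for x
      using d(2)[OF that] \<rho>(2) by linarith
    moreover have "\<rho> \<le> \<bar>Im (\<tau> \<zeta>)\<bar>" using \<rho>(2) by simp
    ultimately show ?thesis unfolding good_def using \<rho>(1,3) by blast
  qed
  then have "\<forall>\<zeta>\<in>\<Xi>. \<exists>\<rho>. good \<zeta> \<rho>" ..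
  from bchoice[OF this] obtain \<rho> where "\<forall>\<zeta>\<in>\<Xi>. good \<zeta> (\<rho> \<zeta>)" ..
  then have \<rho>: "\<And>\<zeta> x. \<zeta> \<in> \<Xi> \<Longrightarrow> x \<in> \<tau> ` \<Xi> \<Longrightarrow> x \<noteq> \<tau> \<zeta> \<Longrightarrow> 2 * \<rho> \<zeta> \<le> dist (\<tau> \<zeta>) x"
    "\<And>\<zeta>. \<zeta> \<in> \<Xi> \<Longrightarrow> \<rho> \<zeta> \<le> \<bar>Im (\<tau> \<zeta>)\<bar>"
    "\<forall>\<zeta>\<in>\<Xi>. \<forall>\<^sub>F m in sequentially. zsum \<zeta> (\<rho> \<zeta>) m = order \<zeta> (cpoly R)"
    unfolding good_def by blast+
  have "\<forall>\<^sub>F m in sequentially. \<forall>\<zeta>\<in>\<Xi>. zsum \<zeta> (\<rho> \<zeta>) m = order \<zeta> (cpoly R)"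
    using fin \<rho>(3) by (rule eventually_ball_finite)
  then show ?thesis
    using eventually_gt_at_top[of 0]
  proof eventually_elim
    case (elim m)
    define Q where "Q = cpoly (shifted_family \<alpha> R m)"
    define A where "A = (\<lambda>\<zeta>. {t \<in> ball (\<tau> \<zeta>) (\<rho> \<zeta>). poly Q (of_nat m * t) = 0})"
    have Q0: "shifted_family \<alpha> R m \<noteq> 0" "Q \<noteq> 0"
      using shifted_family_nonzero[OF assms(1,2)] by (simp_all add: Q_def)
    have "finite ((\<lambda>t. of_nat m * t) -` {z. poly Q z = 0})"
      using \<open>Q \<noteq> 0\<close> elim(2) by (intro finite_vimageI poly_roots_finite) (auto simp: inj_on_def)
    then have finA: "finite (A \<zeta>)" for \<zeta>
      by (rule finite_subset[rotated]) (auto simp: A_def)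
    have disj: "A \<zeta> \<inter> A \<zeta>' = {}" if z: "\<zeta> \<in> \<Xi>" "\<zeta>' \<in> \<Xi>" "\<zeta> \<noteq> \<zeta>'" for \<zeta> \<zeta>'
    proof (rule ccontr)
      assume "A \<zeta> \<inter> A \<zeta>' \<noteq> {}"
      then obtain t where t: "dist (\<tau> \<zeta>) t < \<rho> \<zeta>" "dist (\<tau> \<zeta>') t < \<rho> \<zeta>'" by (auto simp: A_def)
      have "2 * \<rho> \<zeta> \<le> dist (\<tau> \<zeta>) (\<tau> \<zeta>')" "2 * \<rho> \<zeta>' \<le> dist (\<tau> \<zeta>') (\<tau> \<zeta>)"
        using \<rho>(1) z inj[OF z] by auto
      then show False
        using t dist_triangle2[of "\<tau> \<zeta>" "\<tau> \<zeta>'" t] dist_commute[of "\<tau> \<zeta>" "\<tau> \<zeta>'"] by linarith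
    qed
    have nonreal: "of_nat m * t \<notin> \<real>" if "\<zeta> \<in> \<Xi>" "t \<in> A \<zeta>" for \<zeta> t
    proof
      assume "of_nat m * t \<in> \<real>"
      then have "Im t = 0" using elim(2) by (simp add: complex_is_Real_iff)
      then have "\<bar>Im (\<tau> \<zeta>)\<bar> \<le> cmod (\<tau> \<zeta> - t)" using abs_Im_le_cmod[of "\<tau> \<zeta> - t"] by simp
      then show False using that(2) \<rho>(2)[OF that(1)] by (simp add: A_def dist_norm)
    qed
    have "num_nonreal_zeros R = (\<Sum>\<zeta>\<in>\<Xi>. order \<zeta> (cpoly R))"
      using num_nonreal_zeros_eq_sum[OF assms(2)] by (simp add: \<Xi>_def)
    also have "\<dots> = (\<Sum>\<zeta>\<in>\<Xi>. \<Sum>t\<in>A \<zeta>. order (of_nat m * t) Q)"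
      using elim(1) by (intro sum.cong) (simp_all add: A_def Q_def zsum_def)
    also have "\<dots> = (\<Sum>t\<in>(\<Union>\<zeta>\<in>\<Xi>. A \<zeta>). order (of_nat m * t) Q)"
      using fin finA disj by (intro sum.UNION_disjoint[symmetric]) auto
    also have "\<dots> = (\<Sum>z\<in>(\<lambda>t. of_nat m * t) ` (\<Union>\<zeta>\<in>\<Xi>. A \<zeta>). order z Q)"
      using elim(2) by (subst sum.reindex) (auto simp: inj_on_def)
    also have "\<dots> \<le> (\<Sum>z | z \<notin> \<real> \<and> poly Q z = 0. order z Q)"
    proof (rule sum_mono2)
      show "finite {z. z \<notin> \<real> \<and> poly Q z = 0}"
        using Q0(2) by (intro finite_subset[OF _ poly_roots_finite[of Q]]) auto
      show "(\<lambda>t. of_nat m * t) ` (\<Union>\<zeta>\<in>\<Xi>. A \<zeta>) \<subseteq> {z. z \<notin> \<real> \<and> poly Q z = 0}"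
        using nonreal by (auto simp: A_def)
    qed auto
    also have "\<dots> = num_nonreal_zeros (shifted_family \<alpha> R m)"
      using num_nonreal_zeros_eq_sum[OF Q0(1)] by (simp add: Q_def)
    finally show ?case .
  qed
qed

section \<open>Exact counts and the theorem\<close>

lemma proots_pcompose_shift:
  fixes R :: "real poly"
  shows "proots (pcompose R [:1, 1:]) = image_mset (\<lambda>x. x - 1) (proots R)"
proof (induction "size (proots R)" arbitrary: R)
  case 0
  show ?case
  proof (cases "R = 0")
    case False
    have "poly R x \<noteq> 0" for x
      using 0 False set_count_proots[of R] by auto
    then have "proots (pcompose R [:1, 1:]) = {#}"
      using False by (intro multiset_eqI) (simp add: pcompose_eq_0_iff order_0I poly_pcompose)
    then show ?thesis using 0 by simp
  qed simp
next
  case (Suc k)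
  then have "R \<noteq> 0" by auto
  obtain b where "b \<in># proots R" using Suc.hyps(2) by (metis Zero_not_Suc multiset_nonemptyE size_empty)
  then have "poly R b = 0" using \<open>R \<noteq> 0\<close> by simp
  then obtain S where S: "R = [:- b, 1:] * S" by (metis dvdE poly_eq_0_iff_dvd)
  have "S \<noteq> 0" using \<open>R \<noteq> 0\<close> S by auto
  have pr: "proots R = add_mset b (proots S)"
    unfolding S using \<open>S \<noteq> 0\<close> by (subst proots_mult) auto
  have "pcompose R [:1, 1:] = [:1 - b, 1:] * pcompose S [:1, 1:]"
    unfolding S pcompose_mult by (simp add: pcompose_pCons)
  then have "proots (pcompose R [:1, 1:]) = add_mset (b - 1) (proots (pcompose S [:1, 1:]))"
    using \<open>S \<noteq> 0\<close> by (simp only:) (subst proots_mult, auto simp: pcompose_eq_0_iff)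
  then show ?case
    using Suc.hyps(1)[of S] Suc.hyps(2) pr by simp
qed

lemma proots_shifted:
  fixes R :: "real poly"
  assumes "R \<noteq> 0"
  shows "proots ([:1, 1:] ^ m * pcompose R [:1, 1:]) =
           replicate_mset m (- 1) + image_mset (\<lambda>x. x - 1) (proots R)"
  using assms by (subst proots_mult) (auto simp: pcompose_eq_0_iff proots_power proots_pcompose_shift)

lemma degree_shifted:
  fixes R :: "real poly"
  assumes "R \<noteq> 0"
  shows "degree ([:1, 1:] ^ m * pcompose R [:1, 1:]) = degree R + m"
  using assms by (subst degree_mult_eq) (auto simp: pcompose_eq_0_iff degree_power_eq degree_pcompose)

text \<open>The zeros of the preimage are \<open>-1\<close>, \<open>m\<close> times, and the zeros of \<open>R\<close> shifted by \<open>-1\<close>; the positive ones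
  correspond to the zeros of \<open>R\<close> beyond \<open>1\<close>.\<close>

lemma shifted_family_simple_zeros:
  assumes "\<alpha> > -1" "poly R 1 \<noteq> 0"
    and "num_nonreal_zeros R \<le> num_nonreal_zeros (shifted_family \<alpha> R m)"
  shows "has_simple_real_zeros (shifted_family \<alpha> R m) (degree R + m - num_nonreal_zeros R) (num_zeros_gt_one R)"
proof -
  define f where "f = [:1, 1:] ^ m * pcompose R [:1, 1:]"
  define k where "k = size {#x \<in># proots f. x < 0#}"
  define l where "l = size {#x \<in># proots f. x > 0#}"
  let ?q = "shifted_family \<alpha> R m"
  have "R \<noteq> 0" using assms(2) by auto
  have q: "?q = lag_transform \<alpha> f" by (simp add: shifted_family_def f_def)
  have f0: "poly f 0 \<noteq> 0" using assms(2) by (simp add: f_def poly_pcompose)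
  have pr: "proots f = replicate_mset m (- 1) + image_mset (\<lambda>x. x - 1) (proots R)"
    unfolding f_def by (rule proots_shifted) fact
  have "l = num_zeros_gt_one R"
  proof -
    have "{#x \<in># replicate_mset m (- 1 :: real). x > 0#} = {#}"
      by (induction m) auto
    then have "l = size (image_mset (\<lambda>x. x - 1) {#x \<in># proots R. x - 1 > 0#})"
      unfolding l_def pr filter_union_mset by (simp add: filter_mset_image_mset)
    then show ?thesis by (simp add: num_zeros_gt_one_def)
  qed
  have "proots f = {#x \<in># proots f. x < 0#} + {#x \<in># proots f. x > 0#}"
  proof (rule multiset_eqI)
    fix x
    have "count (proots f) 0 = 0" using f0 by (cases "f = 0") (auto simp: order_0I)
    then show "count (proots f) x = count ({#x \<in># proots f. x < 0#} + {#x \<in># proots f. x > 0#}) x"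
      by (cases x "0::real" rule: linorder_cases) (simp_all del: count_proots)
  qed
  then have "size (proots f) = k + l"
    unfolding k_def l_def by (metis size_union)
  then have kl: "k + l = m + size (proots R)" using pr by simp
  have "?q \<noteq> 0" by (rule shifted_family_nonzero) fact+
  have "degree ?q = degree R + m"
    unfolding q degree_lag_transform[OF assms(1)] f_def by (rule degree_shifted) fact
  then have "size (proots ?q) \<le> k + l" "k + l = degree R + m - num_nonreal_zeros R"
    using num_nonreal_zeros_plus_size_proots[OF \<open>?q \<noteq> 0\<close>] num_nonreal_zeros_plus_size_proots[OF \<open>R \<noteq> 0\<close>]
      assms(3) kl by linarith+
  moreover have "poly ?q 0 \<noteq> 0" unfolding q poly_lag_transform_0 by (rule f0)
  ultimately show ?thesis
    using simple_zeros_from_bounds[of ?q k l] lag_transform_zeros_ge[OF assms(1) f0] \<open>l = num_zeros_gt_one R\<close>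
    unfolding q k_def l_def by simp
qed

lemma poly_pderiv_simple_zero:
  fixes p :: "real poly"
  assumes "p \<noteq> 0" "order z p = 1"
  shows "poly (pderiv p) z \<noteq> 0"
proof -
  obtain q where q: "p = [:- z, 1:] ^ order z p * q" "\<not> [:- z, 1:] dvd q"
    using order_decomp[OF assms(1)] by blast
  have p: "p = [:- z, 1:] * q" using q(1) unfolding assms(2) power_one_right .
  have "pderiv [:- z, 1:] = 1" by (simp add: pderiv_pCons)
  then have "poly (pderiv p) z = poly q z" unfolding p pderiv_mult by simp
  then show ?thesis using q(2) by (simp add: poly_eq_0_iff_dvd)
qed

text \<open>Exact counts are needed for \<open>\<alpha>\<close> at \<open>m\<close> and \<open>m + 1\<close>, and for \<open>\<alpha> + 1\<close> at \<open>m\<close>: the last polynomial, times \<open>x\<close>,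
  is the difference of the first two up to a constant.\<close>

lemma shifted_family_interlaces:
  assumes "\<alpha> > -1" "poly R 1 \<noteq> 0"
    and "num_nonreal_zeros R \<le> num_nonreal_zeros (shifted_family \<alpha> R m)"
    and "num_nonreal_zeros R \<le> num_nonreal_zeros (shifted_family \<alpha> R (Suc m))"
    and "num_nonreal_zeros R \<le> num_nonreal_zeros (shifted_family (\<alpha> + 1) R m)"
  shows "interlaces (real_zeros (shifted_family \<alpha> R (Suc m))) (real_zeros (shifted_family \<alpha> R m))"
proof -
  define f where "f = [:1, 1:] ^ m * pcompose R [:1, 1:]"
  define u where "u = shifted_family (\<alpha> + 1) R m"
  define q where "q = shifted_family \<alpha> R m"
  define r where "r = shifted_family \<alpha> R (Suc m)"
  define v where "v = pCons 0 u"
  define c where "c = 1 / (1 + \<alpha>)"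
  have "c > 0" using assms(1) by (simp add: c_def)
  have "\<alpha> + 1 > -1" "R \<noteq> 0" using assms(1,2) by auto
  have nz: "u \<noteq> 0" "q \<noteq> 0" "r \<noteq> 0" "v \<noteq> 0"
    using shifted_family_nonzero \<open>R \<noteq> 0\<close> assms(1) by (auto simp: u_def q_def r_def v_def)
  have q_eq: "poly q x = poly u x + c * (x * poly (pderiv u) x)" for x
    unfolding q_def u_def shifted_family_def lag_transform_lower[OF assms(1), of "[:1, 1:] ^ m * pcompose R [:1, 1:]"]
    by (simp add: c_def)
  have "[:1, 1:] * f = f + pCons 0 f" by simp
  then have "[:1, 1:] ^ Suc m * pcompose R [:1, 1:] = f + pCons 0 f"
    by (simp only: f_def power_Suc mult.assoc)
  then have "r = q + lag_transform \<alpha> (pCons 0 f)"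
    by (simp only: r_def q_def shifted_family_def lag_transform_add f_def)
  then have r_eq: "poly r x = poly q x - c * poly v x" for x
    unfolding lag_transform_mult_X[OF assms(1)] by (simp add: v_def u_def c_def shifted_family_def f_def)
  have v': "poly (pderiv v) x = poly u x + x * poly (pderiv u) x" for x
    by (simp add: v_def pderiv_pCons)
  have "poly u 0 = poly R 1"
    by (simp add: u_def shifted_family_def poly_lag_transform_0 poly_pcompose)
  then have u0: "poly u 0 \<noteq> 0" using assms(2) by simp
  have su: "has_simple_real_zeros u (degree R + m - num_nonreal_zeros R) (num_zeros_gt_one R)"
    unfolding u_def by (rule shifted_family_simple_zeros) fact+
  have sq: "has_simple_real_zeros q (degree R + m - num_nonreal_zeros R) (num_zeros_gt_one R)"
    unfolding q_def by (rule shifted_family_simple_zeros) fact+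
  have sr: "has_simple_real_zeros r (degree R + Suc m - num_nonreal_zeros R) (num_zeros_gt_one R)"
    unfolding r_def by (rule shifted_family_simple_zeros) fact+
  have u': "poly (pderiv u) z \<noteq> 0" if "poly u z = 0" for z
    using su that by (intro poly_pderiv_simple_zero nz) (auto simp: has_simple_real_zeros_def real_zeros_def)
  have N: "num_nonreal_zeros R \<le> degree R"
    using num_nonreal_zeros_plus_size_proots[OF \<open>R \<noteq> 0\<close>] by linarith
  have lead: "lead_coeff (lag_transform \<alpha> g) = lead_coeff g * (- 1) ^ degree g / pochhammer (1 + \<alpha>) (degree g)" for g
    by (simp add: degree_lag_transform[OF assms(1)] coeff_lag_transform)
  have sgn_lead: "sgn (lead_coeff (lag_transform \<alpha> g)) = sgn (lead_coeff g) * (- 1) ^ degree g" for g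
    unfolding lead using pochhammer_pos_shift[OF assms(1), of "degree g"] by (simp add: sgn_mult sgn_divide)
  define g where "g = [:1, 1:] ^ Suc m * pcompose R [:1, 1:]"
  have deg: "degree g = Suc (degree f)"
    unfolding f_def g_def degree_shifted[OF \<open>R \<noteq> 0\<close>] by simp
  have "g = [:1, 1:] * f" by (simp only: f_def g_def power_Suc mult.assoc)
  then have lead_g: "lead_coeff g = lead_coeff f" by (simp only: lead_coeff_mult) simp
  have "r = lag_transform \<alpha> g" "q = lag_transform \<alpha> f"
    by (simp_all only: r_def q_def shifted_family_def f_def g_def)
  then have lead_r: "sgn (lead_coeff r) = - sgn (lead_coeff q)"
    by (simp only: sgn_lead lead_g) (simp add: deg)
  show ?thesis
    unfolding q_def[symmetric] r_def[symmetric]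
  proof (rule interlaces_from_counts[of v q r c])
    show "poly (pderiv v) z \<noteq> 0" if "poly v z = 0" for z
      using that u0 u'[of z] by (auto simp: v_def v'[unfolded v_def])
    show "sgn (poly q z) = sgn (poly (pderiv v) z)" if "poly v z = 0" for z
    proof (cases "z = 0")
      case True
      then show ?thesis by (simp add: q_eq v')
    next
      case False
      then have "poly u z = 0" using that by (simp add: v_def)
      then show ?thesis using \<open>c > 0\<close> by (simp add: q_eq v' sgn_mult)
    qed
    have "real_zeros v = insert 0 (real_zeros u)" by (auto simp: v_def real_zeros_def)
    moreover have "0 \<notin> real_zeros u" using u0 by (simp add: real_zeros_def)
    moreover have "finite (real_zeros u)" using nz by (simp add: real_zeros_def poly_roots_finite)
    ultimately have "card (real_zeros v) = Suc (card (real_zeros u))" by simp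
    then show "card (real_zeros v) = Suc (card (real_zeros q))"
      using su sq by (simp add: has_simple_real_zeros_def)
    show "card (real_zeros r) = Suc (card (real_zeros q))"
      using sr sq N by (simp add: has_simple_real_zeros_def)
    show "degree r = Suc (degree q)"
      unfolding r_def q_def shifted_family_def degree_lag_transform[OF assms(1)] degree_shifted[OF \<open>R \<noteq> 0\<close>] by simp
  qed (use nz r_eq \<open>c > 0\<close> lead_r in auto)
qed

lemma shifted_family_zeros:
  assumes "\<alpha> > -1" "poly R 1 \<noteq> 0"
    and "\<And>z. z \<notin> \<real> \<Longrightarrow> cmod z \<le> 1 \<Longrightarrow> poly (cpoly R) z \<noteq> 0"
  shows "\<exists>m0. (num_nonreal_zeros R = 0 \<longrightarrow> m0 = 0) \<and>
    (\<forall>m\<ge>m0. has_simple_real_zeros (shifted_family \<alpha> R m) (degree R + m - num_nonreal_zeros R) (num_zeros_gt_one R) \<and>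
       interlaces (real_zeros (shifted_family \<alpha> R (Suc m))) (real_zeros (shifted_family \<alpha> R m)))"
proof -
  have "R \<noteq> 0" using assms(2) by auto
  have "\<exists>m0. (num_nonreal_zeros R = 0 \<longrightarrow> m0 = 0) \<and>
      (\<forall>m\<ge>m0. num_nonreal_zeros R \<le> num_nonreal_zeros (shifted_family \<alpha> R m) \<and>
         num_nonreal_zeros R \<le> num_nonreal_zeros (shifted_family (\<alpha> + 1) R m))"
  proof (cases "num_nonreal_zeros R = 0")
    case False
    have "\<alpha> + 1 > -1" using assms(1) by simp
    have "\<forall>\<^sub>F m in sequentially. num_nonreal_zeros R \<le> num_nonreal_zeros (shifted_family \<alpha> R m) \<and>
        num_nonreal_zeros R \<le> num_nonreal_zeros (shifted_family (\<alpha> + 1) R m)"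
      by (intro eventually_conj eventually_num_nonreal_zeros_ge assms \<open>R \<noteq> 0\<close> \<open>\<alpha> + 1 > -1\<close>)
    then obtain m0 where "\<forall>m\<ge>m0. num_nonreal_zeros R \<le> num_nonreal_zeros (shifted_family \<alpha> R m) \<and>
        num_nonreal_zeros R \<le> num_nonreal_zeros (shifted_family (\<alpha> + 1) R m)"
      unfolding eventually_at_top_linorder ..
    then show ?thesis using False by (intro exI[of _ m0] conjI impI) simp_all
  qed simp
  then obtain m0 where "(num_nonreal_zeros R = 0 \<longrightarrow> m0 = 0) \<and>
      (\<forall>m\<ge>m0. num_nonreal_zeros R \<le> num_nonreal_zeros (shifted_family \<alpha> R m) \<and>
         num_nonreal_zeros R \<le> num_nonreal_zeros (shifted_family (\<alpha> + 1) R m))" ..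
  then have m0: "num_nonreal_zeros R = 0 \<longrightarrow> m0 = 0"
    "\<And>m. m \<ge> m0 \<Longrightarrow> num_nonreal_zeros R \<le> num_nonreal_zeros (shifted_family \<alpha> R m)"
    "\<And>m. m \<ge> m0 \<Longrightarrow> num_nonreal_zeros R \<le> num_nonreal_zeros (shifted_family (\<alpha> + 1) R m)"
    by blast+
  show ?thesis
  proof (intro exI[of _ m0] conjI allI impI)
    fix m assume m: "m \<ge> m0"
    show "has_simple_real_zeros (shifted_family \<alpha> R m) (degree R + m - num_nonreal_zeros R) (num_zeros_gt_one R)"
      by (rule shifted_family_simple_zeros[OF assms(1,2) m0(2)[OF m]])
    show "interlaces (real_zeros (shifted_family \<alpha> R (Suc m))) (real_zeros (shifted_family \<alpha> R m))"
      by (rule shifted_family_interlaces[OF assms(1,2) m0(2)[OF m] m0(2)[OF le_SucI[OF m]] m0(3)[OF m]])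
  qed (use m0(1) in blast)
qed

lemma real_zeros_smult: "c \<noteq> 0 \<Longrightarrow> real_zeros (smult c p) = real_zeros p"
  by (simp add: real_zeros_def)

lemma has_simple_real_zeros_smult:
  "c \<noteq> 0 \<Longrightarrow> has_simple_real_zeros (smult c p) m k = has_simple_real_zeros p m k"
  by (simp add: has_simple_real_zeros_def real_zeros_smult order_smult)

theorem theorem1p4:
  fixes \<alpha> :: real and K :: nat and \<gamma> :: "nat \<Rightarrow> real"
    and P :: "real poly" and q :: "nat \<Rightarrow> real poly" and Nnr N1 :: nat
  assumes "\<alpha> > -1" and "K > 0" and "\<gamma> 0 = 1" and "\<gamma> K \<noteq> 0"
  defines "P \<equiv> charpoly K \<gamma>"
    and "q \<equiv> lagcomb \<alpha> K \<gamma>"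
    and "Nnr \<equiv> num_nonreal_zeros P"
    and "N1 \<equiv> num_zeros_gt_one P"
  assumes "\<And>z :: complex. z \<notin> \<real> \<Longrightarrow> norm z \<le> 1 \<Longrightarrow> poly (map_poly complex_of_real P) z \<noteq> 0"
  shows "(poly P 1 \<noteq> 0 \<longrightarrow>
            (Nnr = 0 \<longrightarrow>
               (\<forall>n\<ge>K. has_simple_real_zeros (q n) n N1 \<and>
                      interlaces (real_zeros (q (n + 1))) (real_zeros (q n)))) \<and>
            (Nnr \<noteq> 0 \<longrightarrow>
               (\<exists>n0\<ge>K. \<forall>n\<ge>n0. has_simple_real_zeros (q n) (n - Nnr) N1 \<and>
                      interlaces (real_zeros (q (n + 1))) (real_zeros (q n))))) \<and>
         (\<forall>s>0. order 1 P = s \<longrightarrow>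
            (\<forall>n\<ge>K. order 0 (q n) = s \<and> degree (q n div monom 1 s) = n - s) \<and>
            (Nnr = 0 \<longrightarrow>
               (\<forall>n\<ge>K. has_simple_real_zeros (q n div monom 1 s) (n - s) N1 \<and>
                      interlaces (real_zeros (q (n + 1) div monom 1 s))
                                 (real_zeros (q n div monom 1 s)))) \<and>
            (Nnr \<noteq> 0 \<longrightarrow>
               (\<exists>n0\<ge>K. \<forall>n\<ge>n0. has_simple_real_zeros (q n div monom 1 s) (n - s - Nnr) N1 \<and>
                      interlaces (real_zeros (q (n + 1) div monom 1 s))
                                 (real_zeros (q n div monom 1 s)))))"
proof -
  define s where "s = order 1 P"
  have degP: "degree P = K" unfolding P_def by (rule degree_charpoly) fact
  then have "P \<noteq> 0" using assms(2) by auto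
  obtain R where R: "P = [:- 1, 1:] ^ s * R" "\<not> [:- 1, 1:] dvd R"
    using order_decomp[OF \<open>P \<noteq> 0\<close>, of 1] by (auto simp: s_def)
  have R1: "poly R 1 \<noteq> 0" using R(2) by (simp add: poly_eq_0_iff_dvd)
  then have "R \<noteq> 0" by auto
  have degK: "K = s + degree R"
    using degP \<open>R \<noteq> 0\<close> unfolding R(1) by (simp add: degree_mult_eq degree_power_eq)
  have prP: "proots P = replicate_mset s 1 + proots R"
    unfolding R(1) using \<open>R \<noteq> 0\<close> by (subst proots_mult) (auto simp: proots_power)
  have Nnr: "Nnr = num_nonreal_zeros R"
    unfolding Nnr_def
    using num_nonreal_zeros_plus_size_proots[OF \<open>P \<noteq> 0\<close>] num_nonreal_zeros_plus_size_proots[OF \<open>R \<noteq> 0\<close>]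
      prP degP degK by simp
  have "{#x \<in># replicate_mset s (1 :: real). x > 1#} = {#}" by (induction s) auto
  then have N1: "N1 = num_zeros_gt_one R"
    unfolding N1_def num_zeros_gt_one_def prP by simp
  define \<beta> where "\<beta> = \<alpha> + real s"
  have "\<beta> > -1" using assms(1) by (simp add: \<beta>_def)
  have R_nz: "poly (cpoly R) z \<noteq> 0" if "z \<notin> \<real>" "cmod z \<le> 1" for z
  proof -
    have "poly (cpoly P) z \<noteq> 0" by (rule assms(9)) fact+
    moreover have "poly (cpoly P) z = poly (cpoly ([:- 1, 1:] ^ s)) z * poly (cpoly R) z"
      by (subst R(1)) (simp only: cpoly_mult poly_mult)
    ultimately show ?thesis by simp
  qed
  obtain m0 where "(num_nonreal_zeros R = 0 \<longrightarrow> m0 = 0) \<and>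
    (\<forall>m\<ge>m0. has_simple_real_zeros (shifted_family \<beta> R m) (degree R + m - num_nonreal_zeros R) (num_zeros_gt_one R) \<and>
       interlaces (real_zeros (shifted_family \<beta> R (Suc m))) (real_zeros (shifted_family \<beta> R m)))"
    using shifted_family_zeros[OF \<open>\<beta> > -1\<close> R1 R_nz] ..
  then have m0: "num_nonreal_zeros R = 0 \<longrightarrow> m0 = 0"
    "\<And>m. m \<ge> m0 \<Longrightarrow> has_simple_real_zeros (shifted_family \<beta> R m) (degree R + m - num_nonreal_zeros R) (num_zeros_gt_one R)"
    "\<And>m. m \<ge> m0 \<Longrightarrow> interlaces (real_zeros (shifted_family \<beta> R (Suc m))) (real_zeros (shifted_family \<beta> R m))"
    by simp_all
  have q_eq: "\<exists>c. c \<noteq> 0 \<and> q n = smult c (monom 1 s * shifted_family \<beta> R (n - K))" if "n \<ge> K" for n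
  proof -
    have "pcompose P [:1, 1:] = monom 1 s * pcompose R [:1, 1:]"
    proof (rule poly_ext)
      fix x
      have "poly P (1 + x) = x ^ s * poly R (1 + x)"
        by (subst R(1)) (simp add: poly_power)
      then show "poly (pcompose P [:1, 1:]) x = poly (monom 1 s * pcompose R [:1, 1:]) x"
        by (simp add: poly_pcompose poly_monom)
    qed
    then have "q n = lag_transform \<alpha> (monom 1 s * ([:1, 1:] ^ (n - K) * pcompose R [:1, 1:]))"
      unfolding q_def P_def using lagcomb_eq_lag_transform[of \<alpha> \<gamma> K n] assms(1,3) that
      by (simp add: mult.left_commute)
    then show ?thesis
      using lag_transform_monom_mult[OF assms(1)] unfolding shifted_family_def \<beta>_def by metis
  qed
  have div_eq: "\<exists>c. c \<noteq> 0 \<and> q n div monom 1 s = smult c (shifted_family \<beta> R (n - K))" if n: "n \<ge> K" for n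
  proof -
    obtain c where c: "c \<noteq> 0" "q n = smult c (monom 1 s * shifted_family \<beta> R (n - K))"
      using q_eq[OF n] by blast
    have "monom (1::real) s \<noteq> 0" by simp
    have "q n = monom 1 s * smult c (shifted_family \<beta> R (n - K))" unfolding c(2) by simp
    then have "q n div monom 1 s = smult c (shifted_family \<beta> R (n - K))"
      using nonzero_mult_div_cancel_left[OF \<open>monom (1::real) s \<noteq> 0\<close>] by (simp only:)
    then show ?thesis using c(1) by blast
  qed
  have main: "has_simple_real_zeros (q n div monom 1 s) (n - s - Nnr) N1 \<and>
     interlaces (real_zeros (q (n + 1) div monom 1 s)) (real_zeros (q n div monom 1 s))"
    if n: "n \<ge> K + m0" for n
  proof -
    obtain c where c: "c \<noteq> 0" "q n div monom 1 s = smult c (shifted_family \<beta> R (n - K))"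
      using div_eq[of n] n by auto
    have "Suc n - K = Suc (n - K)" using n by simp
    then obtain d where d: "d \<noteq> 0" "q (n + 1) div monom 1 s = smult d (shifted_family \<beta> R (Suc (n - K)))"
      using div_eq[of "n + 1"] n by auto
    have "degree R + (n - K) - num_nonreal_zeros R = n - s - Nnr"
      using n degK Nnr by simp
    then show ?thesis
      using m0(2,3)[of "n - K"] n
      unfolding c(2) d(2) N1 by (simp add: has_simple_real_zeros_smult[OF c(1)] real_zeros_smult c(1) d(1))
  qed
  have ord: "order 0 (q n) = s \<and> degree (q n div monom 1 s) = n - s" if n: "n \<ge> K" for n
  proof
    obtain c where c: "c \<noteq> 0" "q n = smult c (monom 1 s * shifted_family \<beta> R (n - K))"
      using q_eq[OF n] by blast
    have "poly (shifted_family \<beta> R (n - K)) 0 \<noteq> 0"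
      using R1 by (simp add: shifted_family_def poly_lag_transform_0 poly_pcompose)
    moreover have "shifted_family \<beta> R (n - K) \<noteq> 0"
      by (rule shifted_family_nonzero) fact+
    ultimately show "order 0 (q n) = s"
      unfolding c(2) using c(1) by (simp add: order_smult order_mult order_0I)
    have "degree (shifted_family \<beta> R (n - K)) = n - s"
      unfolding shifted_family_def degree_lag_transform[OF \<open>\<beta> > -1\<close>] degree_shifted[OF \<open>R \<noteq> 0\<close>]
      using n degK by simp
    then show "degree (q n div monom 1 s) = n - s"
      using div_eq[OF n] by auto
  qed
  have m00: "Nnr = 0 \<Longrightarrow> m0 = 0" using m0(1) Nnr by simp
  have s0: "q n div monom 1 s = q n" if "s = 0" for n using that by simp
  have part1: "poly P 1 \<noteq> 0 \<Longrightarrow> s = 0" by (simp add: s_def order_0I)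
  have mainK: "Nnr = 0 \<Longrightarrow> n \<ge> K \<Longrightarrow> has_simple_real_zeros (q n div monom 1 s) (n - s) N1 \<and>
     interlaces (real_zeros (q (n + 1) div monom 1 s)) (real_zeros (q n div monom 1 s))" for n
    using main[of n] m00 by simp
  show ?thesis
  proof (intro conjI impI allI)
    fix n assume "poly P 1 \<noteq> 0" "Nnr = 0" "n \<ge> K"
    then show "has_simple_real_zeros (q n) n N1" "interlaces (real_zeros (q (n + 1))) (real_zeros (q n))"
      using mainK[of n] part1 by simp_all
  next
    assume "poly P 1 \<noteq> 0"
    then have "\<forall>n\<ge>K + m0. has_simple_real_zeros (q n) (n - Nnr) N1 \<and>
                      interlaces (real_zeros (q (n + 1))) (real_zeros (q n))"
      using main part1 by simp
    then show "\<exists>n0\<ge>K. \<forall>n\<ge>n0. has_simple_real_zeros (q n) (n - Nnr) N1 \<and>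
                      interlaces (real_zeros (q (n + 1))) (real_zeros (q n))"
      by (intro exI[of _ "K + m0"]) auto
  next
    fix s' n assume "order 1 P = s'" "n \<ge> K"
    then show "order 0 (q n) = s'" "degree (q n div monom 1 s') = n - s'"
      using ord[of n] by (auto simp: s_def)
  next
    fix s' n assume "order 1 P = s'" "Nnr = 0" "n \<ge> K"
    then show "has_simple_real_zeros (q n div monom 1 s') (n - s') N1"
      "interlaces (real_zeros (q (n + 1) div monom 1 s')) (real_zeros (q n div monom 1 s'))"
      using mainK[of n] by (auto simp: s_def)
  next
    fix s' assume "order 1 P = s'"
    then show "\<exists>n0\<ge>K. \<forall>n\<ge>n0. has_simple_real_zeros (q n div monom 1 s') (n - s' - Nnr) N1 \<and>
                      interlaces (real_zeros (q (n + 1) div monom 1 s'))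
                                 (real_zeros (q n div monom 1 s'))"
      using main by (intro exI[of _ "K + m0"]) (auto simp: s_def)
  qed
qed

end
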